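(* Fix $a > 1$, let $p = \frac{a \log n}{n}$, let $z \in \{\pm1\}^n$, and let $\delta \in [0,1]$. Let the graph $G=(V,E)$ on $V=\{1,\dots,n\}$ be sampled from the Erdős–Rényi distribution $\mathcal{G}(n,p)$ and suppose that we observe, for the pairs $(i,j)\in E$, the random measurements $$R_{ij} = R_{ji} = \begin{cases} z_i z_j & \text{with probability } \frac{1+\delta}{2},\\ -z_i z_j & \text{with probability } \frac{1-\delta}{2},\end{cases}$$ independently across edges. Suppose, for some $\epsilon > 0$, $$a\left(1 - \sqrt{1-\delta^2}\right) \geq 1 + \epsilon.$$ Then there exists a constant $r_0$, depending only on $a$ and $\epsilon$, such that, with probability $\to 1$ as $n\to\infty$, the following holds: if the cost matrix $C \in \mathbf{R}^{n\times n}$ is defined by $$C_{ij} = \begin{cases} R_{ij} & \text{if } (i,j)\in E,\\ 0 & \text{otherwise,}\end{cases}$$ then, for all integers $r \geq r_0$, every second-order critical point $Y\in\mathbf{R}^{n\times r}$ of the problem $$\max_{Y \in \mathbf{R}^{n\times r}}~\langle C, YY^\top\rangle \quad \text{s.t. } \mathrm{ddiag}(YY^\top) = I_n$$ satisfies $Y = z u^\top$ for some unit-norm $u\in\mathbf{R}^r$.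
   Context: In $\mathcal{G}(n,p)$ each possible undirected edge $(i,j)$, $i\ne j$, is present with probability $p$ independently of the others. (For the asymptotic statement only $n$ large enough that $p\le 1$ matters.) $\langle A,B\rangle = \mathrm{trace}(A^\top B)$ is the Frobenius inner product; $\mathrm{ddiag}\colon \mathbf{R}^{n\times n}\to\mathbf{R}^{n\times n}$ keeps the diagonal of a matrix and sets the off-diagonal entries to zero. The constraint $\mathrm{ddiag}(YY^\top)=I_n$ says that every row of $Y$ is a unit vector in $\mathbf{R}^r$, so the feasible set is a Riemannian manifold (a product of $n$ unit spheres embedded in $\mathbf{R}^r$). A second-order critical point is a feasible $Y$ at which the Riemannian gradient of the objective is zero and the Riemannian Hessian is negative semidefinite. Explicitly, for symmetric $C$, put $S(Y) = \mathrm{ddiag}(CYY^\top) - C$; a feasible $Y$ is second-order critical if and only if (i) $S(Y)Y = 0$, and (ii) $\langle S(Y), \dot Y \dot Y^\top\rangle \ge 0$ for every $\dot Y\in\mathbf{R}^{n\times r}$ such that $\mathrm{ddiag}(Y\dot Y^\top)=0$. *)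

theory Defs
  imports
    "HOL-Probability.Probability"
    "HOL-Library.Ramsey"
    "Jordan_Normal_Form.Matrix"
begin

no_notation vec_nth (infixl \<open>$\<close> 90)
unbundle no inner_syntax

definition mat_trace :: "real mat \<Rightarrow> real" where
  "mat_trace A = (\<Sum>i<dim_row A. A $$ (i, i))"

definition frob_inner :: "real mat \<Rightarrow> real mat \<Rightarrow> real" where
  "frob_inner A B = mat_trace (A\<^sup>T * B)"

definition ddiag :: "real mat \<Rightarrow> real mat" where
  "ddiag A = mat (dim_row A) (dim_col A) (\<lambda>(i, j). if i = j then A $$ (i, j) else 0)"

definition outer_prod :: "real vec \<Rightarrow> real vec \<Rightarrow> real mat" where
  "outer_prod x y = mat (dim_vec x) (dim_vec y) (\<lambda>(i, j). x $ i * y $ j)"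

definition mat_unit :: "nat \<Rightarrow> nat \<Rightarrow> nat \<Rightarrow> nat \<Rightarrow> real mat" where
  "mat_unit n r i j = mat n r (\<lambda>(k, l). if k = i \<and> l = j then 1 else 0)"

definition sign_vecs :: "nat \<Rightarrow> real vec set" where
  "sign_vecs n = {z \<in> carrier_vec n. \<forall>i<n. z $ i \<in> {-1, 1}}"

definition feasible :: "nat \<Rightarrow> nat \<Rightarrow> real mat set" where
  "feasible n r = {Y \<in> carrier_mat n r. ddiag (Y * Y\<^sup>T) = 1\<^sub>m n}"

definition tangent_space :: "real mat \<Rightarrow> real mat set" where
  "tangent_space Y = {V \<in> carrier_mat (dim_row Y) (dim_col Y).
     ddiag (Y * V\<^sup>T) = 0\<^sub>m (dim_row Y) (dim_row Y)}"

text \<open>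
  For feasible \<open>Y\<close>, the Frobenius-orthogonal projection onto the tangent space at \<open>Y\<close>
  (see \<open>tangent_proj_in_tangent_space\<close> and \<open>tangent_proj_orthogonal\<close> below).
\<close>

definition tangent_proj :: "real mat \<Rightarrow> real mat \<Rightarrow> real mat" where
  "tangent_proj Y Z = Z - ddiag (Z * Y\<^sup>T) * Y"

definition euclidean_grad :: "(real mat \<Rightarrow> real) \<Rightarrow> real mat \<Rightarrow> real mat" where
  "euclidean_grad f Y = mat (dim_row Y) (dim_col Y)
     (\<lambda>(i, j). deriv (\<lambda>t. f (Y + t \<cdot>\<^sub>m mat_unit (dim_row Y) (dim_col Y) i j)) 0)"

definition dir_deriv :: "(real mat \<Rightarrow> real mat) \<Rightarrow> real mat \<Rightarrow> real mat \<Rightarrow> real mat" where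
  "dir_deriv F Y V = mat (dim_row Y) (dim_col Y)
     (\<lambda>(i, j). deriv (\<lambda>t. F (Y + t \<cdot>\<^sub>m V) $$ (i, j)) 0)"

text \<open>
  The manifold of feasible matrices carries the metric inherited from the ambient matrix space.
  So the Riemannian gradient is the tangential part of the Euclidean gradient, and the
  Riemannian Hessian in the direction \<open>V\<close> is the tangential part of the directional derivative
  of any smooth extension of the gradient field to a neighbourhood of the manifold; the formula
  defining \<open>riem_grad\<close> is such an extension. The objective \<open>f\<close> has to be smooth on the ambient
  space, since \<open>deriv\<close> is unspecified where the derivative does not exist.
\<close>

definition riem_grad :: "(real mat \<Rightarrow> real) \<Rightarrow> real mat \<Rightarrow> real mat" where
  "riem_grad f Y = tangent_proj Y (euclidean_grad f Y)"

definition riem_hess :: "(real mat \<Rightarrow> real) \<Rightarrow> real mat \<Rightarrow> real mat \<Rightarrow> real mat" where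
  "riem_hess f Y V = tangent_proj Y (dir_deriv (riem_grad f) Y V)"

text \<open>
  The sign condition on the Hessian is the one for maximizing \<open>f\<close>. For the quadratic objective,
  \<open>second_order_critical_quadratic_iff\<close> below gives the usual explicit form in terms of
  \<open>S = ddiag (C Y Y\<^sup>T) - C\<close>.
\<close>

definition second_order_critical :: "nat \<Rightarrow> nat \<Rightarrow> (real mat \<Rightarrow> real) \<Rightarrow> real mat \<Rightarrow> bool" where
  "second_order_critical n r f Y \<longleftrightarrow>
     Y \<in> feasible n r \<and>
     riem_grad f Y = 0\<^sub>m n r \<and>
     (\<forall>V\<in>tangent_space Y. frob_inner V (riem_hess f Y V) \<le> 0)"

text \<open>
  Vertices are \<open>0, \<dots>, n - 1\<close>, and an undirected edge is a two-element set of vertices.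
  Note that \<open>bernoulli_pmf\<close> truncates its parameter to the unit interval.
\<close>

definition erdos_renyi :: "nat \<Rightarrow> real \<Rightarrow> nat set set pmf" where
  "erdos_renyi n p =
     map_pmf (\<lambda>present. {e \<in> [{..<n}]\<^bsup>2\<^esup>. present e})
       (Pi_pmf ([{..<n}]\<^bsup>2\<^esup>) False (\<lambda>_. bernoulli_pmf p))"

text \<open>
  Conditionally on the edge set \<open>E\<close>, the measurements are independent over the edges. A
  measurement \<open>R e\<close> is indexed by an unordered pair, which makes it symmetric by construction;
  for \<open>e = {i, j}\<close> the product over \<open>e\<close> is \<open>z\<^sub>i z\<^sub>j\<close>.
\<close>

definition measurements :: "real vec \<Rightarrow> real \<Rightarrow> nat set set \<Rightarrow> (nat set \<Rightarrow> real) pmf" where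
  "measurements z \<delta> E =
     Pi_pmf E 0 (\<lambda>e. map_pmf (\<lambda>correct. if correct then (\<Prod>k\<in>e. z $ k) else - (\<Prod>k\<in>e. z $ k))
       (bernoulli_pmf ((1 + \<delta>) / 2)))"

definition synchronization_model ::
    "nat \<Rightarrow> real \<Rightarrow> real vec \<Rightarrow> real \<Rightarrow> (nat set set \<times> (nat set \<Rightarrow> real)) pmf" where
  "synchronization_model n p z \<delta> =
     bind_pmf (erdos_renyi n p) (\<lambda>E. map_pmf (\<lambda>R. (E, R)) (measurements z \<delta> E))"

definition cost_matrix :: "nat \<Rightarrow> nat set set \<Rightarrow> (nat set \<Rightarrow> real) \<Rightarrow> real mat" where
  "cost_matrix n E R = mat n n (\<lambda>(i, j). if {i, j} \<in> E then R {i, j} else 0)"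

lemma frob_inner_eq_sum:
  assumes "A \<in> carrier_mat n m" "B \<in> carrier_mat n m"
  shows "frob_inner A B = (\<Sum>i<n. \<Sum>j<m. A $$ (i, j) * B $$ (i, j))"
proof -
  have "frob_inner A B = (\<Sum>j<m. \<Sum>i<n. A $$ (i, j) * B $$ (i, j))"
    using assms by (auto simp: frob_inner_def mat_trace_def scalar_prod_def atLeast0LessThan
        intro!: sum.cong)
  then show ?thesis by (simp add: sum.swap[of _ "{..<m}"])
qed

lemma dim_ddiag [simp]: "dim_row (ddiag A) = dim_row A" "dim_col (ddiag A) = dim_col A"
  by (simp_all add: ddiag_def)

lemma ddiag_carrier [simp]: "A \<in> carrier_mat n m \<Longrightarrow> ddiag A \<in> carrier_mat n m"
  by (auto simp: ddiag_def)

lemma ddiag_mult_index: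
  assumes "A \<in> carrier_mat n n" "Y \<in> carrier_mat n r" "i < n" "j < r"
  shows "(ddiag A * Y) $$ (i, j) = A $$ (i, i) * Y $$ (i, j)"
proof -
  have "(ddiag A * Y) $$ (i, j) = (\<Sum>k<n. (if i = k then A $$ (i, k) else 0) * Y $$ (k, j))"
    using assms by (auto simp: ddiag_def scalar_prod_def atLeast0LessThan intro!: sum.cong)
  also have "\<dots> = (\<Sum>k<n. if i = k then A $$ (i, k) * Y $$ (k, j) else 0)"
    by (intro sum.cong) auto
  finally show ?thesis using assms by simp
qed

lemma mult_transpose_index:
  assumes "Y \<in> carrier_mat n r" "V \<in> carrier_mat m r" "i < n" "j < m"
  shows "(Y * V\<^sup>T) $$ (i, j) = (\<Sum>k<r. Y $$ (i, k) * V $$ (j, k))"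
  using assms by (auto simp: scalar_prod_def atLeast0LessThan intro!: sum.cong)

lemma tangent_proj_carrier:
  assumes "Y \<in> carrier_mat n r" "Z \<in> carrier_mat n r"
  shows "tangent_proj Y Z \<in> carrier_mat n r"
  using assms by (auto simp: tangent_proj_def ddiag_def)

lemma tangent_proj_index:
  assumes "Y \<in> carrier_mat n r" "Z \<in> carrier_mat n r" "i < n" "j < r"
  shows "tangent_proj Y Z $$ (i, j) =
    Z $$ (i, j) - (\<Sum>k<r. Z $$ (i, k) * Y $$ (i, k)) * Y $$ (i, j)"
proof -
  have ZY: "Z * Y\<^sup>T \<in> carrier_mat n n" using assms by auto
  have "ddiag (Z * Y\<^sup>T) * Y \<in> carrier_mat n r"
    using ddiag_carrier[OF ZY] assms(1) by (rule mult_carrier_mat)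
  then have "tangent_proj Y Z $$ (i, j) = Z $$ (i, j) - (ddiag (Z * Y\<^sup>T) * Y) $$ (i, j)"
    using assms by (simp add: tangent_proj_def del: index_mult_mat(1))
  also have "(ddiag (Z * Y\<^sup>T) * Y) $$ (i, j) = (Z * Y\<^sup>T) $$ (i, i) * Y $$ (i, j)"
    by (rule ddiag_mult_index[OF ZY assms(1,3,4)])
  also have "(Z * Y\<^sup>T) $$ (i, i) = (\<Sum>k<r. Z $$ (i, k) * Y $$ (i, k))"
    by (rule mult_transpose_index[OF assms(2,1,3,3)])
  finally show ?thesis .
qed

lemma tangent_space_iff:
  assumes "Y \<in> carrier_mat n r"
  shows "V \<in> tangent_space Y \<longleftrightarrow>
    V \<in> carrier_mat n r \<and> (\<forall>i<n. (\<Sum>k<r. Y $$ (i, k) * V $$ (i, k)) = 0)"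
proof -
  have "ddiag (Y * V\<^sup>T) = 0\<^sub>m n n \<longleftrightarrow> (\<forall>i<n. (Y * V\<^sup>T) $$ (i, i) = 0)"
    if "V \<in> carrier_mat n r"
    using assms that by (auto simp: mat_eq_iff ddiag_def simp del: index_mult_mat(1))
  then show ?thesis
    using assms by (auto simp: tangent_space_def mult_transpose_index simp del: index_mult_mat(1))
qed

lemma feasible_iff:
  "Y \<in> feasible n r \<longleftrightarrow> Y \<in> carrier_mat n r \<and> (\<forall>i<n. (\<Sum>k<r. Y $$ (i, k) * Y $$ (i, k)) = 1)"
proof -
  have "ddiag (Y * Y\<^sup>T) = 1\<^sub>m n \<longleftrightarrow> (\<forall>i<n. (Y * Y\<^sup>T) $$ (i, i) = 1)"
    if "Y \<in> carrier_mat n r"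
    using that by (auto simp: mat_eq_iff ddiag_def simp del: index_mult_mat(1))
  then show ?thesis
    by (auto simp: feasible_def mult_transpose_index simp del: index_mult_mat(1))
qed

lemma tangent_proj_in_tangent_space:
  assumes Y: "Y \<in> feasible n r" and Z: "Z \<in> carrier_mat n r"
  shows "tangent_proj Y Z \<in> tangent_space Y"
proof -
  have Yc: "Y \<in> carrier_mat n r" using Y by (simp add: feasible_iff)
  have "(\<Sum>k<r. Y $$ (i, k) * tangent_proj Y Z $$ (i, k)) = 0" if i: "i < n" for i
  proof -
    define s where "s = (\<Sum>k<r. Z $$ (i, k) * Y $$ (i, k))"
    have "(\<Sum>k<r. Y $$ (i, k) * tangent_proj Y Z $$ (i, k)) =
        (\<Sum>k<r. Z $$ (i, k) * Y $$ (i, k) - s * (Y $$ (i, k) * Y $$ (i, k)))"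
      using Yc Z i by (intro sum.cong) (auto simp: tangent_proj_index s_def algebra_simps)
    also have "\<dots> = s - s * (\<Sum>k<r. Y $$ (i, k) * Y $$ (i, k))"
      by (simp add: sum_subtractf sum_distrib_left s_def)
    finally show ?thesis using Y i by (simp add: feasible_iff)
  qed
  then show ?thesis
    using tangent_proj_carrier[OF Yc Z] tangent_space_iff[OF Yc] by blast
qed

lemma frob_inner_tangent_proj:
  assumes Y: "Y \<in> carrier_mat n r" and Z: "Z \<in> carrier_mat n r" and V: "V \<in> tangent_space Y"
  shows "frob_inner V (tangent_proj Y Z) = frob_inner V Z"
proof -
  have Vc: "V \<in> carrier_mat n r"
    and V0: "\<And>i. i < n \<Longrightarrow> (\<Sum>k<r. Y $$ (i, k) * V $$ (i, k)) = 0"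
    using V Y by (auto simp: tangent_space_iff)
  have "(\<Sum>j<r. V $$ (i, j) * tangent_proj Y Z $$ (i, j)) = (\<Sum>j<r. V $$ (i, j) * Z $$ (i, j))"
    if i: "i < n" for i
  proof -
    define s where "s = (\<Sum>k<r. Z $$ (i, k) * Y $$ (i, k))"
    have "(\<Sum>j<r. V $$ (i, j) * tangent_proj Y Z $$ (i, j)) =
        (\<Sum>j<r. V $$ (i, j) * Z $$ (i, j) - s * (Y $$ (i, j) * V $$ (i, j)))"
      using Y Z i by (intro sum.cong) (auto simp: tangent_proj_index s_def algebra_simps)
    also have "\<dots> = (\<Sum>j<r. V $$ (i, j) * Z $$ (i, j)) - s * (\<Sum>j<r. Y $$ (i, j) * V $$ (i, j))"
      by (simp add: sum_subtractf sum_distrib_left)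
    finally show ?thesis using V0[OF i] by simp
  qed
  then show ?thesis
    by (simp add: frob_inner_eq_sum[OF Vc tangent_proj_carrier[OF Y Z]] frob_inner_eq_sum[OF Vc Z])
qed

lemma tangent_proj_orthogonal:
  assumes "Y \<in> feasible n r" "Z \<in> carrier_mat n r" "V \<in> tangent_space Y"
  shows "frob_inner V (Z - tangent_proj Y Z) = 0"
proof -
  have Y: "Y \<in> carrier_mat n r" using assms by (simp add: feasible_iff)
  then have Vc: "V \<in> carrier_mat n r" using assms(3) by (simp add: tangent_space_iff)
  have P: "tangent_proj Y Z \<in> carrier_mat n r" using tangent_proj_carrier[OF Y assms(2)] .
  then have "Z - tangent_proj Y Z \<in> carrier_mat n r" by (rule minus_carrier_mat)
  then have "frob_inner V (Z - tangent_proj Y Z) = frob_inner V Z - frob_inner V (tangent_proj Y Z)"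
    using Vc P assms(2) by (simp add: frob_inner_eq_sum[where n = n and m = r] right_diff_distrib sum_subtractf)
  then show ?thesis using frob_inner_tangent_proj[OF Y assms(2,3)] by simp
qed

lemma frob_inner_gram:
  assumes "C \<in> carrier_mat n n" "Y \<in> carrier_mat n r"
  shows "frob_inner C (Y * Y\<^sup>T) =
    (\<Sum>i<n. \<Sum>j<n. \<Sum>k<r. C $$ (i, j) * (Y $$ (i, k) * Y $$ (j, k)))"
proof -
  have "Y * Y\<^sup>T \<in> carrier_mat n n" using assms by auto
  then show ?thesis using assms
    by (simp add: frob_inner_eq_sum mult_transpose_index sum_distrib_left del: index_mult_mat(1))
qed

lemma euclidean_grad_quadratic:
  assumes C: "C \<in> carrier_mat n n" and sym: "C\<^sup>T = C" and Y: "Y \<in> carrier_mat n r"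
  shows "euclidean_grad (\<lambda>Y. frob_inner C (Y * Y\<^sup>T)) Y = 2 \<cdot>\<^sub>m (C * Y)"
proof (rule eq_matI)
  fix i j assume "i < dim_row (2 \<cdot>\<^sub>m (C * Y))" "j < dim_col (2 \<cdot>\<^sub>m (C * Y))"
  then have i: "i < n" and j: "j < r" using C Y by auto
  have sym': "C $$ (b, a) = C $$ (a, b)" if "a < n" "b < n" for a b
    using C sym that index_transpose_mat(1)[of a C b] by (metis carrier_matD)
  define E where "E = mat_unit n r i j"
  have E: "E \<in> carrier_mat n r" by (simp add: E_def mat_unit_def)
  have Ei: "E $$ (a, k) = of_bool (a = i) * of_bool (k = j)" if "a < n" "k < r" for a k
    using that by (simp add: E_def mat_unit_def)
  define g where "g t = (\<Sum>a<n. \<Sum>b<n. \<Sum>k<r. C $$ (a, b) *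
      ((Y $$ (a, k) + t * E $$ (a, k)) * (Y $$ (b, k) + t * E $$ (b, k))))" for t :: real
  have f: "frob_inner C ((Y + t \<cdot>\<^sub>m E) * (Y + t \<cdot>\<^sub>m E)\<^sup>T) = g t" for t
  proof -
    have "Y + t \<cdot>\<^sub>m E \<in> carrier_mat n r" using Y E by simp
    then show ?thesis using Y E
      by (subst frob_inner_gram[OF C]) (auto simp: g_def intro!: sum.cong)
  qed
  have "(g has_real_derivative (\<Sum>a<n. \<Sum>b<n. \<Sum>k<r. C $$ (a, b) *
      (E $$ (a, k) * Y $$ (b, k) + Y $$ (a, k) * E $$ (b, k)))) (at 0)"
    unfolding g_def by (auto intro!: derivative_eq_intros sum.cong)
  also have "(\<Sum>a<n. \<Sum>b<n. \<Sum>k<r. C $$ (a, b) *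
      (E $$ (a, k) * Y $$ (b, k) + Y $$ (a, k) * E $$ (b, k))) =
      (\<Sum>a<n. \<Sum>b<n. \<Sum>k<r. C $$ (a, b) * (E $$ (a, k) * Y $$ (b, k))) +
      (\<Sum>a<n. \<Sum>b<n. \<Sum>k<r. C $$ (a, b) * (Y $$ (a, k) * E $$ (b, k)))"
    by (simp add: distrib_left sum.distrib)
  also have "(\<Sum>a<n. \<Sum>b<n. \<Sum>k<r. C $$ (a, b) * (Y $$ (a, k) * E $$ (b, k))) =
      (\<Sum>b<n. \<Sum>a<n. \<Sum>k<r. C $$ (a, b) * (Y $$ (a, k) * E $$ (b, k)))"
    by (rule sum.swap)
  also have "\<dots> = (\<Sum>a<n. \<Sum>b<n. \<Sum>k<r. C $$ (a, b) * (E $$ (a, k) * Y $$ (b, k)))"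
    by (intro sum.cong) (auto simp: sym' mult.commute)
  also have "(\<Sum>a<n. \<Sum>b<n. \<Sum>k<r. C $$ (a, b) * (E $$ (a, k) * Y $$ (b, k))) =
      (\<Sum>a<n. of_bool (a = i) * (\<Sum>b<n. C $$ (a, b) * (\<Sum>k<r. of_bool (k = j) * Y $$ (b, k))))"
    unfolding sum_distrib_left by (intro sum.cong refl) (simp add: Ei mult.assoc mult.left_commute del: of_bool_eq)
  also have "\<dots> = (\<Sum>b<n. C $$ (i, b) * Y $$ (b, j))"
    using i j by (simp add: of_bool_def if_distrib[of "\<lambda>x. x * _"] cong: if_cong)
  also have "\<dots> = (C * Y) $$ (i, j)"
    using C Y i j by (auto simp: scalar_prod_def atLeast0LessThan intro!: sum.cong)
  finally have "deriv g 0 = 2 * (C * Y) $$ (i, j)" by (auto dest: DERIV_imp_deriv)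
  then show "euclidean_grad (\<lambda>Y. frob_inner C (Y * Y\<^sup>T)) Y $$ (i, j) = (2 \<cdot>\<^sub>m (C * Y)) $$ (i, j)"
    using C Y i j by (simp add: euclidean_grad_def f flip: E_def del: index_mult_mat(1))
qed (use C Y in \<open>auto simp: euclidean_grad_def\<close>)

lemma second_order_critical_quadratic_iff:
  assumes C: "C \<in> carrier_mat n n" and sym: "C\<^sup>T = C"
  defines "S \<equiv> (\<lambda>Y. ddiag (C * Y * Y\<^sup>T) - C)"
  shows "second_order_critical n r (\<lambda>Y. frob_inner C (Y * Y\<^sup>T)) Y \<longleftrightarrow>
    Y \<in> feasible n r \<and> S Y * Y = 0\<^sub>m n r \<and>
    (\<forall>V\<in>carrier_mat n r. ddiag (Y * V\<^sup>T) = 0\<^sub>m n n \<longrightarrow> frob_inner (S Y) (V * V\<^sup>T) \<ge> 0)"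
proof (cases "Y \<in> feasible n r")
  case feas: True
  then have Y: "Y \<in> carrier_mat n r" by (simp add: feasible_iff)
  define f where "f = (\<lambda>Y. frob_inner C (Y * Y\<^sup>T))"
  have CX: "(C * X) $$ (i, j) = (\<Sum>b<n. C $$ (i, b) * X $$ (b, j))"
    if "X \<in> carrier_mat n r" "i < n" "j < r" for X i j
    using C that by (auto simp: scalar_prod_def atLeast0LessThan intro!: sum.cong)
  have grad: "riem_grad f X $$ (i, j) = 2 * (C * X) $$ (i, j) -
      2 * (\<Sum>k<r. (C * X) $$ (i, k) * X $$ (i, k)) * X $$ (i, j)"
    if X: "X \<in> carrier_mat n r" and "i < n" "j < r" for X i j
  proof -
    have "2 \<cdot>\<^sub>m (C * X) \<in> carrier_mat n r" using C X by simp
    then show ?thesis using C that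
      by (simp add: riem_grad_def f_def euclidean_grad_quadratic[OF C sym X] tangent_proj_index
          sum_distrib_left mult.assoc del: index_mult_mat(1))
  qed
  have grad_carrier: "riem_grad f Y \<in> carrier_mat n r"
    using C Y by (simp add: riem_grad_def f_def euclidean_grad_quadratic[OF C sym Y]
        tangent_proj_carrier)
  have CYY: "C * Y * Y\<^sup>T \<in> carrier_mat n n" using C Y by simp
  define l where "l i = (\<Sum>k<r. (C * Y) $$ (i, k) * Y $$ (i, k))" for i
  have l: "(C * Y * Y\<^sup>T) $$ (i, i) = l i" if "i < n" for i
    unfolding l_def by (rule mult_transpose_index[OF mult_carrier_mat[OF C Y] Y that that])
  have S: "S Y \<in> carrier_mat n n" unfolding S_def by (rule minus_carrier_mat[OF C])
  have SV: "(S Y * X) $$ (i, j) = l i * X $$ (i, j) - (C * X) $$ (i, j)"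
    if X: "X \<in> carrier_mat n r" and ij: "i < n" "j < r" for X i j
  proof -
    have "S Y * X = ddiag (C * Y * Y\<^sup>T) * X - C * X"
      unfolding S_def using CYY C X by (intro minus_mult_distrib_mat) auto
    moreover have "ddiag (C * Y * Y\<^sup>T) * X \<in> carrier_mat n r"
      using ddiag_carrier[OF CYY] X by (rule mult_carrier_mat)
    ultimately show ?thesis
      using C X ij l by (simp add: ddiag_mult_index[OF CYY X ij] del: index_mult_mat(1))
  qed
  have first: "riem_grad f Y = 0\<^sub>m n r \<longleftrightarrow> S Y * Y = 0\<^sub>m n r"
  proof -
    have "riem_grad f Y = 0\<^sub>m n r \<longleftrightarrow> (\<forall>i<n. \<forall>j<r. riem_grad f Y $$ (i, j) = 0)"
      using grad_carrier by (auto simp: mat_eq_iff)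
    also have "\<dots> \<longleftrightarrow> (\<forall>i<n. \<forall>j<r. (S Y * Y) $$ (i, j) = 0)"
      using Y by (auto simp: grad SV l_def simp del: index_mult_mat(1))
    also have "\<dots> \<longleftrightarrow> S Y * Y = 0\<^sub>m n r"
      using S Y by (auto simp: mat_eq_iff simp del: index_mult_mat(1))
    finally show ?thesis .
  qed
  have second: "frob_inner V (riem_hess f Y V) = - 2 * frob_inner (S Y) (V * V\<^sup>T)"
    if V: "V \<in> tangent_space Y" for V
  proof -
    have Vc: "V \<in> carrier_mat n r"
      and V0: "\<And>i. i < n \<Longrightarrow> (\<Sum>k<r. Y $$ (i, k) * V $$ (i, k)) = 0"
      using V Y by (auto simp: tangent_space_iff)
    have D: "dir_deriv (riem_grad f) Y V \<in> carrier_mat n r"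
      using Y by (simp add: dir_deriv_def)
    define w where "w i = (\<Sum>k<r. (C * V) $$ (i, k) * Y $$ (i, k) + (C * Y) $$ (i, k) * V $$ (i, k))" for i
    have D_index: "dir_deriv (riem_grad f) Y V $$ (i, j) =
        - 2 * (S Y * V) $$ (i, j) - 2 * w i * Y $$ (i, j)" if ij: "i < n" "j < r" for i j
    proof -
      define h where "h t = 2 * ((C * Y) $$ (i, j) + t * (C * V) $$ (i, j)) -
        2 * (\<Sum>k<r. ((C * Y) $$ (i, k) + t * (C * V) $$ (i, k)) * (Y $$ (i, k) + t * V $$ (i, k))) *
          (Y $$ (i, j) + t * V $$ (i, j))" for t
      have "riem_grad f (Y + t \<cdot>\<^sub>m V) $$ (i, j) = h t" for t
      proof -
        have X: "Y + t \<cdot>\<^sub>m V \<in> carrier_mat n r" using Y Vc by simp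
        have "C * (Y + t \<cdot>\<^sub>m V) = C * Y + t \<cdot>\<^sub>m (C * V)"
          using C Y Vc by (simp add: mult_add_distrib_mat[of C n n Y r] mult_smult_distrib)
        then show ?thesis
          using ij C Y Vc by (simp add: grad[OF X ij] h_def del: index_mult_mat(1))
      qed
      then have "dir_deriv (riem_grad f) Y V $$ (i, j) = deriv h 0"
        using Y ij by (simp add: dir_deriv_def)
      also have "(h has_real_derivative 2 * (C * V) $$ (i, j) - 2 * (w i * Y $$ (i, j) + l i * V $$ (i, j))) (at 0)"
        unfolding h_def w_def l_def
        by (rule derivative_eq_intros refl | simp del: index_mult_mat(1))+
          (simp add: algebra_simps sum.distrib del: index_mult_mat(1))
      then have "deriv h 0 = 2 * (C * V) $$ (i, j) - 2 * (w i * Y $$ (i, j) + l i * V $$ (i, j))"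
        by (rule DERIV_imp_deriv)
      finally show ?thesis by (simp add: SV[OF Vc ij] algebra_simps)
    qed
    have SVc: "S Y * V \<in> carrier_mat n r" using S Vc by simp
    have "frob_inner V (riem_hess f Y V) = frob_inner V (dir_deriv (riem_grad f) Y V)"
      unfolding riem_hess_def by (rule frob_inner_tangent_proj[OF Y D V])
    also have "\<dots> = (\<Sum>i<n. \<Sum>j<r. - 2 * (V $$ (i, j) * (S Y * V) $$ (i, j)) -
        2 * w i * (Y $$ (i, j) * V $$ (i, j)))"
      unfolding frob_inner_eq_sum[OF Vc D]
      by (intro sum.cong) (auto simp: D_index algebra_simps simp del: index_mult_mat(1))
    also have "\<dots> = (\<Sum>i<n. - 2 * (\<Sum>j<r. V $$ (i, j) * (S Y * V) $$ (i, j)) -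
        2 * w i * (\<Sum>j<r. Y $$ (i, j) * V $$ (i, j)))"
      by (simp add: sum_subtractf sum_distrib_left del: index_mult_mat(1))
    also have "\<dots> = - 2 * (\<Sum>i<n. \<Sum>j<r. V $$ (i, j) * (S Y * V) $$ (i, j))"
      by (simp add: V0 sum_distrib_left del: index_mult_mat(1))
    also have "(\<Sum>i<n. \<Sum>j<r. V $$ (i, j) * (S Y * V) $$ (i, j)) =
        (\<Sum>i<n. \<Sum>j<r. \<Sum>b<n. S Y $$ (i, b) * (V $$ (i, j) * V $$ (b, j)))"
      using S Vc by (auto simp: scalar_prod_def atLeast0LessThan sum_distrib_left algebra_simps
          intro!: sum.cong)
    also have "\<dots> = (\<Sum>i<n. \<Sum>b<n. \<Sum>j<r. S Y $$ (i, b) * (V $$ (i, j) * V $$ (b, j)))"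
      by (rule sum.cong[OF refl], rule sum.swap)
    also have "\<dots> = frob_inner (S Y) (V * V\<^sup>T)"
      by (rule frob_inner_gram[OF S Vc, symmetric])
    finally show ?thesis .
  qed
  have tangent: "V \<in> tangent_space Y \<longleftrightarrow> V \<in> carrier_mat n r \<and> ddiag (Y * V\<^sup>T) = 0\<^sub>m n n" for V
    using Y by (simp add: tangent_space_def)
  have "(\<forall>V\<in>tangent_space Y. frob_inner V (riem_hess f Y V) \<le> 0) \<longleftrightarrow>
      (\<forall>V\<in>tangent_space Y. frob_inner (S Y) (V * V\<^sup>T) \<ge> 0)"
    by (intro ball_cong refl) (simp only: second, linarith)
  then have "second_order_critical n r f Y \<longleftrightarrow> Y \<in> feasible n r \<and> S Y * Y = 0\<^sub>m n r \<and>
      (\<forall>V\<in>tangent_space Y. frob_inner (S Y) (V * V\<^sup>T) \<ge> 0)"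
    by (simp only: second_order_critical_def first)
  then show ?thesis
    unfolding f_def tangent Ball_def by blast
qed (simp add: second_order_critical_def)

end

theory Submission
  imports Defs "HOL-Real_Asymp.Real_Asymp"
begin

text \<open>
  Changing the sign of row \<open>i\<close> of \<open>Y\<close> by \<open>z\<^sub>i\<close> turns the problem into one whose hidden signs are all
  \<open>1\<close>: the cost becomes a random signed graph with independent weights \<open>w\<^sub>e \<in> {-1, 0, 1}\<close> of mean
  \<open>p * \<delta>\<close> (\<open>map_gauged_synchronization_model\<close>), and the claim becomes that all rows of a critical
  point agree. Everything is expressed through the Dirichlet form of \<open>w\<close>, that is, the quadratic form
  of the signed graph Laplacian.

  Suppose first that on vectors with sum zero the Dirichlet form lies between \<open>m\<close> and \<open>M\<close> times
  the squared norm, with \<open>m > 0\<close>. Let \<open>X\<^sub>i\<close> be the gauged rows and \<open>G = X X\<^sup>T\<close>. Test the second-order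
  condition with the tangent vectors that move every row towards a common direction,
  \<open>V\<^sub>i = \<Gamma> - \<langle>\<Gamma>, X\<^sub>i\<rangle> X\<^sub>i\<close>, and sum over an orthonormal basis of directions \<open>\<Gamma>\<close>. The result is
  \<open>(r - 1) \<Sum> w\<^sub>i\<^sub>j (1 - G\<^sub>i\<^sub>j) \<le> \<Sum> w\<^sub>i\<^sub>j (1 - G\<^sub>i\<^sub>j\<^sup>2)\<close>
  (\<open>second_order_averaged\<close>). Both sides are sums of Dirichlet forms, the left one of the coordinates of
  \<open>X\<^sub>i\<close> and the right one of the coordinates of \<open>X\<^sub>i \<otimes> X\<^sub>i\<close>. If \<open>s\<close> is the mean of the entries of \<open>G\<close>, the
  window gives \<open>(r - 1) m (1 - s) \<le> M (1 - s\<^sup>2) \<le> 2 M (1 - s)\<close>, so \<open>s = 1\<close> as soon as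
  \<open>(r - 1) m > 2 M\<close>, and then all rows coincide (\<open>second_order_critical_aligned\<close>). It remains to see
  that \<open>m\<close> and \<open>M\<close> can both be taken of order \<open>ln n\<close>.

  The bound \<open>M\<close> comes from the maximal degree, which is \<open>O(ln n)\<close>. For \<open>m\<close>, write the
  Dirichlet form as (signed degrees) - (adjacency form). With high probability every signed degree is at least \<open>c ln n\<close>:
  the hypothesis \<open>a (1 - sqrt (1 - \<delta>\<^sup>2)) \<ge> 1 + \<epsilon>\<close> makes the Chernoff bound for one vertex \<open>o(1/n)\<close>. On
  vectors with sum zero the adjacency form is at most the centred form
  \<open>\<Sum> (w\<^sub>e - p \<delta>) x\<^sub>i x\<^sub>j\<close>, for which a bound by a small multiple of \<open>ln n\<close> suffices
  (\<open>spectral_window_of_regular\<close>). This is shown in the style of Kahn and Szemeredi. As the form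
  has no diagonal it is affine in each coordinate, so the coordinates can be rounded to integers
  without decreasing it, which leaves \<open>exp (O(n))\<close> vectors. Pairs with \<open>|x\<^sub>i x\<^sub>j| \<le> \<tau> ln n\<close> are controlled
  by a Chernoff bound and a union bound over these vectors; the remaining pairs are controlled
  deterministically (\<open>heavy_pairs_bound\<close>) because a set of \<open>O(n / ln n)\<close> vertices spans few edges.
\<close>

section \<open>The landscape over a signed graph with a spectral window\<close>

lemma sum_rotate3:
  "(\<Sum>k\<in>A. \<Sum>i\<in>B. \<Sum>j\<in>C. f k i j) = (\<Sum>i\<in>B. \<Sum>j\<in>C. \<Sum>k\<in>A. f k i j)"
  for f :: "_ \<Rightarrow> _ \<Rightarrow> _ \<Rightarrow> real"
  by (rule trans[OF sum.swap]) (intro sum.cong refl, rule sum.swap)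

lemma sum_rotate4:
  "(\<Sum>k\<in>A. \<Sum>l\<in>B. \<Sum>i\<in>C. \<Sum>j\<in>D. f k l i j) = (\<Sum>i\<in>C. \<Sum>j\<in>D. \<Sum>k\<in>A. \<Sum>l\<in>B. f k l i j)"
  for f :: "_ \<Rightarrow> _ \<Rightarrow> _ \<Rightarrow> _ \<Rightarrow> real"
  by (rule trans[OF sum.cong[OF refl sum_rotate3] sum_rotate3])

text \<open>
  The weights are indexed by unordered pairs, hence symmetric. Loops \<open>{i}\<close> contribute nothing,
  and the factor \<open>1/2\<close> makes every edge count once.
\<close>
definition dirichlet :: "nat \<Rightarrow> (nat set \<Rightarrow> real) \<Rightarrow> (nat \<Rightarrow> real) \<Rightarrow> real" where
  "dirichlet n w f = (\<Sum>i<n. \<Sum>j<n. w {i, j} * (f i - f j)\<^sup>2) / 2"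

text \<open>
  The nontrivial spectrum of the signed Laplacian lies in \<open>[m, M]\<close>.
\<close>
definition spectral_window :: "nat \<Rightarrow> (nat set \<Rightarrow> real) \<Rightarrow> real \<Rightarrow> real \<Rightarrow> bool" where
  "spectral_window n w m M \<longleftrightarrow>
     (\<forall>f. (\<Sum>i<n. f i) = 0 \<longrightarrow>
        m * (\<Sum>i<n. (f i)\<^sup>2) \<le> dirichlet n w f \<and> dirichlet n w f \<le> M * (\<Sum>i<n. (f i)\<^sup>2))"

text \<open>
  The Dirichlet form does not change under adding constants, so an arbitrary vector may be replaced
  by its centred version, whose squared norm is the variance term below.
\<close>
lemma spectral_window_uncentred:
  assumes win: "spectral_window n w m M" and n: "n > 0"
  shows "m * ((\<Sum>i<n. (f i)\<^sup>2) - (\<Sum>i<n. f i)\<^sup>2 / n) \<le> dirichlet n w f"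
    and "dirichlet n w f \<le> M * ((\<Sum>i<n. (f i)\<^sup>2) - (\<Sum>i<n. f i)\<^sup>2 / n)"
proof -
  define c where "c = (\<Sum>i<n. f i) / n"
  define g where "g i = f i - c" for i
  have nc: "real n * c = (\<Sum>i<n. f i)" using n by (simp add: c_def)
  have g0: "(\<Sum>i<n. g i) = 0"
    using nc by (simp add: g_def sum_subtractf)
  have "(\<Sum>i<n. (g i)\<^sup>2) = (\<Sum>i<n. (f i)\<^sup>2 - 2 * c * f i + c\<^sup>2)"
    by (simp add: g_def power2_diff algebra_simps)
  also have "\<dots> = (\<Sum>i<n. (f i)\<^sup>2) - 2 * c * (\<Sum>i<n. f i) + c * (real n * c)"
    by (simp add: sum.distrib sum_subtractf sum_distrib_left power2_eq_square mult.left_commute)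
  also have "\<dots> = (\<Sum>i<n. (f i)\<^sup>2) - c * (\<Sum>i<n. f i)"
    by (simp add: nc)
  also have "c * (\<Sum>i<n. f i) = (\<Sum>i<n. f i)\<^sup>2 / n"
    by (simp add: c_def power2_eq_square)
  finally have g2: "(\<Sum>i<n. (g i)\<^sup>2) = (\<Sum>i<n. (f i)\<^sup>2) - (\<Sum>i<n. f i)\<^sup>2 / n" .
  have "dirichlet n w g = dirichlet n w f"
    by (simp add: dirichlet_def g_def)
  with win g0 g2 show "m * ((\<Sum>i<n. (f i)\<^sup>2) - (\<Sum>i<n. f i)\<^sup>2 / n) \<le> dirichlet n w f"
    "dirichlet n w f \<le> M * ((\<Sum>i<n. (f i)\<^sup>2) - (\<Sum>i<n. f i)\<^sup>2 / n)"
    unfolding spectral_window_def by metis+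
qed

text \<open>
  For a fixed basis vector \<open>e\<^sub>k\<close> the direction \<open>V\<^sub>i = z\<^sub>i (e\<^sub>k - \<langle>e\<^sub>k, X\<^sub>i\<rangle> X\<^sub>i)\<close> is tangent. Summed over \<open>k\<close>,
  the inner products \<open>\<langle>V\<^sub>i, V\<^sub>j\<rangle>\<close> become \<open>z\<^sub>i z\<^sub>j (r - 2 + G\<^sub>i\<^sub>j\<^sup>2)\<close>, so that the second-order
  conditions add up to an inequality between the Gram matrix and its entrywise square.
\<close>
lemma second_order_averaged:
  fixes z :: "real vec" and Y :: "real mat"
  assumes z: "z \<in> sign_vecs n"
    and C: "C = mat n n (\<lambda>(i, j). z $ i * z $ j * w {i, j})"
    and crit: "second_order_critical n r (\<lambda>X. frob_inner C (X * X\<^sup>T)) Y"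
  defines "G \<equiv> \<lambda>i j. \<Sum>k<r. (z $ i * Y $$ (i, k)) * (z $ j * Y $$ (j, k))"
  shows "(real r - 1) * (\<Sum>i<n. \<Sum>j<n. w {i, j} * (1 - G i j))
    \<le> (\<Sum>i<n. \<Sum>j<n. w {i, j} * (1 - (G i j)\<^sup>2))"
proof -
  have z2: "z $ i * z $ i = 1" if "i < n" for i
    using z that by (auto simp: sign_vecs_def)
  have Cc: "C \<in> carrier_mat n n" by (simp add: C)
  have sym: "C\<^sup>T = C"
    by (auto simp: C mat_eq_iff insert_commute)
  define x where "x i k = z $ i * Y $$ (i, k)" for i k
  have Gx: "G i j = (\<Sum>k<r. x i k * x j k)" for i j by (simp add: G_def x_def)
  define S where "S = ddiag (C * Y * Y\<^sup>T) - C"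
  from crit have feas: "Y \<in> feasible n r"
    and so: "\<And>V. V \<in> carrier_mat n r \<Longrightarrow> ddiag (Y * V\<^sup>T) = 0\<^sub>m n n \<Longrightarrow> frob_inner S (V * V\<^sup>T) \<ge> 0"
    unfolding second_order_critical_quadratic_iff[OF Cc sym] S_def by blast+
  from feas have Y: "Y \<in> carrier_mat n r"
    and Y1: "\<And>i. i < n \<Longrightarrow> (\<Sum>k<r. Y $$ (i, k) * Y $$ (i, k)) = 1"
    by (auto simp: feasible_iff)
  have G1: "G i i = 1" if "i < n" for i
  proof -
    have "G i i = (\<Sum>k<r. (z $ i * z $ i) * (Y $$ (i, k) * Y $$ (i, k)))"
      by (simp add: G_def algebra_simps)
    then show ?thesis using Y1 z2 that by simp
  qed
  define l where "l i = (\<Sum>j<n. w {i, j} * G i j)" for i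
  have CYY: "C * Y * Y\<^sup>T \<in> carrier_mat n n" using Cc Y by simp
  have Sc: "S \<in> carrier_mat n n" unfolding S_def by (rule minus_carrier_mat[OF Cc])
  have S: "S $$ (i, j) = (if i = j then l i else 0) - z $ i * z $ j * w {i, j}"
    if ij: "i < n" "j < n" for i j
  proof -
    have "(C * Y * Y\<^sup>T) $$ (i, i) = (\<Sum>k<r. (C * Y) $$ (i, k) * Y $$ (i, k))"
      by (rule mult_transpose_index[OF mult_carrier_mat[OF Cc Y] Y ij(1) ij(1)])
    also have "\<dots> = (\<Sum>k<r. (\<Sum>b<n. z $ i * z $ b * w {i, b} * Y $$ (b, k)) * Y $$ (i, k))"
      using Y ij by (intro sum.cong refl) (simp add: C scalar_prod_def atLeast0LessThan)
    also have "\<dots> = (\<Sum>b<n. \<Sum>k<r. z $ i * z $ b * w {i, b} * Y $$ (b, k) * Y $$ (i, k))"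
      by (simp add: sum_distrib_right sum.swap[of _ "{..<n}"])
    also have "\<dots> = l i"
      by (simp add: l_def G_def sum_distrib_left algebra_simps)
    finally have "(C * Y * Y\<^sup>T) $$ (i, i) = l i" .
    moreover have "S $$ (i, j) = ddiag (C * Y * Y\<^sup>T) $$ (i, j) - C $$ (i, j)"
      unfolding S_def using CYY Cc ij by (intro index_minus_mat) auto
    moreover have "ddiag (C * Y * Y\<^sup>T) $$ (i, j) = (if i = j then (C * Y * Y\<^sup>T) $$ (i, j) else 0)"
      using carrier_matD[OF CYY] ij by (simp add: ddiag_def del: index_mult_mat)
    moreover have "C $$ (i, j) = z $ i * z $ j * w {i, j}" using ij by (simp add: C)
    ultimately show ?thesis by (auto simp del: index_mult_mat)
  qed
  \<comment> \<open>Up to the sign \<open>z\<^sub>i\<close>, \<open>v k i\<close> is the projection of \<open>e\<^sub>k\<close> to the tangent space of the sphere at row \<open>i\<close>.\<close>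
  define d where "d k l = (if l = k then 1 else 0 :: real)" for k l :: nat
  define v where "v k i l = d k l - x i k * x i l" for k i l
  have vv: "(\<Sum>l<r. v k i l * v k j l) = 1 - (x i k)\<^sup>2 - (x j k)\<^sup>2 + x i k * x j k * G i j"
    if k: "k < r" for k i j
  proof -
    have "(\<Sum>l<r. v k i l * v k j l) = (\<Sum>l<r. d k l * d k l - d k l * (x j k * x j l)
        - d k l * (x i k * x i l) + x i k * x j k * (x i l * x j l))"
      by (intro sum.cong refl) (simp add: v_def algebra_simps)
    also have "\<dots> = (\<Sum>l<r. d k l * d k l) - (\<Sum>l<r. d k l * (x j k * x j l))
        - (\<Sum>l<r. d k l * (x i k * x i l)) + x i k * x j k * G i j"
      by (simp add: sum.distrib sum_subtractf sum_distrib_left Gx)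
    also have "\<dots> = 1 - (x i k)\<^sup>2 - (x j k)\<^sup>2 + x i k * x j k * G i j"
      using k by (simp add: d_def power2_eq_square if_distrib[of "\<lambda>t. t * _"] cong: if_cong)
    finally show ?thesis .
  qed
  have quad: "0 \<le> (\<Sum>i<n. \<Sum>j<n. S $$ (i, j) * (z $ i * z $ j) * (\<Sum>l<r. v k i l * v k j l))"
    if k: "k < r" for k
  proof -
    define V where "V = mat n r (\<lambda>(i, l). z $ i * v k i l)"
    have V: "V \<in> carrier_mat n r" by (simp add: V_def)
    have Vi: "V $$ (i, l) = z $ i * v k i l" if "i < n" "l < r" for i l
      using that by (simp add: V_def)
    have "(\<Sum>l<r. Y $$ (i, l) * V $$ (i, l)) = 0" if i: "i < n" for i
    proof -
      have "(\<Sum>l<r. Y $$ (i, l) * V $$ (i, l)) = (\<Sum>l<r. d k l * x i l - x i k * (x i l * x i l))"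
        using i by (intro sum.cong refl) (simp add: Vi v_def x_def algebra_simps)
      also have "\<dots> = (\<Sum>l<r. d k l * x i l) - x i k * G i i"
        by (simp add: sum_subtractf sum_distrib_left Gx)
      also have "\<dots> = 0"
        using k G1[OF i] by (simp add: d_def if_distrib[of "\<lambda>t. t * _"] cong: if_cong)
      finally show ?thesis .
    qed
    then have "V \<in> tangent_space Y" using V by (simp add: tangent_space_iff[OF Y])
    then have "ddiag (Y * V\<^sup>T) = 0\<^sub>m n n" using Y by (simp add: tangent_space_def)
    from so[OF V this] have "0 \<le> (\<Sum>i<n. \<Sum>j<n. \<Sum>l<r. S $$ (i, j) * (V $$ (i, l) * V $$ (j, l)))"
      by (simp add: frob_inner_gram[OF Sc V])
    also have "\<dots> = (\<Sum>i<n. \<Sum>j<n. S $$ (i, j) * (z $ i * z $ j) * (\<Sum>l<r. v k i l * v k j l))"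
      by (intro sum.cong refl) (simp add: Vi sum_distrib_left algebra_simps)
    finally show ?thesis .
  qed
  have tot: "(\<Sum>k<r. \<Sum>l<r. v k i l * v k j l) = real r - 2 + (G i j)\<^sup>2" if "i < n" "j < n" for i j
  proof -
    have "(\<Sum>k<r. \<Sum>l<r. v k i l * v k j l) =
        (\<Sum>k<r. 1 - x i k * x i k - x j k * x j k + (x i k * x j k) * G i j)"
      by (intro sum.cong refl) (simp add: vv power2_eq_square)
    also have "\<dots> = real r - G i i - G j j + G i j * G i j"
      by (simp add: sum.distrib sum_subtractf Gx flip: sum_distrib_right)
    finally show ?thesis using G1 that by (simp add: power2_eq_square)
  qed
  have "0 \<le> (\<Sum>k<r. \<Sum>i<n. \<Sum>j<n. S $$ (i, j) * (z $ i * z $ j) * (\<Sum>l<r. v k i l * v k j l))"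
    by (rule sum_nonneg) (use quad in auto)
  also have "\<dots> = (\<Sum>i<n. \<Sum>j<n. \<Sum>k<r. S $$ (i, j) * (z $ i * z $ j) * (\<Sum>l<r. v k i l * v k j l))"
    by (rule sum_rotate3)
  also have "\<dots> = (\<Sum>i<n. \<Sum>j<n. S $$ (i, j) * (z $ i * z $ j) * (real r - 2 + (G i j)\<^sup>2))"
    by (intro sum.cong refl) (simp add: tot flip: sum_distrib_left)
  also have "\<dots> = (\<Sum>i<n. \<Sum>j<n. (if i = j then l i * (real r - 1) else 0)
      - w {i, j} * (real r - 2 + (G i j)\<^sup>2))"
  proof (intro sum.cong refl)
    fix i j assume "i \<in> {..<n}" "j \<in> {..<n}"
    then have ij: "i < n" "j < n" by auto
    have "z $ i * z $ j * w {i, j} * (z $ i * z $ j) = (z $ i * z $ i) * (z $ j * z $ j) * w {i, j}"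
      by (simp add: algebra_simps)
    then have e: "z $ i * z $ j * w {i, j} * (z $ i * z $ j) = w {i, j}"
      using z2 ij by simp
    have S': "S $$ (i, j) * (z $ i * z $ j) = (if i = j then l i else 0) - w {i, j}"
    proof (cases "i = j")
      case True
      then show ?thesis
        using e z2[OF ij(2)] unfolding S[OF ij] left_diff_distrib by simp
    qed (use e in \<open>simp add: S[OF ij] left_diff_distrib\<close>)
    show "S $$ (i, j) * (z $ i * z $ j) * (real r - 2 + (G i j)\<^sup>2) =
      (if i = j then l i * (real r - 1) else 0) - w {i, j} * (real r - 2 + (G i j)\<^sup>2)"
      unfolding S' using G1[OF ij(1)] by (auto simp: left_diff_distrib)
  qed
  also have "\<dots> = (\<Sum>i<n. l i * (real r - 1)) - (\<Sum>i<n. \<Sum>j<n. w {i, j} * (real r - 2 + (G i j)\<^sup>2))"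
    by (simp add: sum_subtractf)
  also have "\<dots> = (\<Sum>i<n. \<Sum>j<n. w {i, j} * (1 - (G i j)\<^sup>2))
      - (real r - 1) * (\<Sum>i<n. \<Sum>j<n. w {i, j} * (1 - G i j))"
    by (simp add: l_def sum_distrib_right sum_distrib_left algebra_simps flip: sum_subtractf sum.distrib)
  finally show ?thesis by simp
qed

text \<open>
  With \<open>s\<close> the mean entry of the Gram matrix \<open>G\<close>, the averaged condition compares a multiple of \<open>1 - s\<close>
  with a multiple of \<open>1 - s\<^sup>2 \<le> 2 (1 - s)\<close>. A rank that beats twice the condition number \<open>M / m\<close> therefore forces \<open>s = 1\<close>. The entries of \<open>G\<close> are
  at most \<open>1\<close>, so all of them are then \<open>1\<close>.
\<close>
lemma second_order_critical_aligned:
  fixes z :: "real vec" and Y :: "real mat"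
  assumes n: "n > 0" and z: "z \<in> sign_vecs n"
    and C: "C = mat n n (\<lambda>(i, j). z $ i * z $ j * w {i, j})"
    and win: "spectral_window n w m M" and M: "M \<ge> 0" and r: "(real r - 1) * m > 2 * M"
    and r1: "r \<ge> 1"
    and crit: "second_order_critical n r (\<lambda>X. frob_inner C (X * X\<^sup>T)) Y"
  shows "\<exists>u\<in>carrier_vec r. u \<bullet> u = 1 \<and> Y = outer_prod z u"
proof -
  from crit have feas: "Y \<in> feasible n r" by (simp add: second_order_critical_def)
  then have Y: "Y \<in> carrier_mat n r"
    and Y1: "\<And>i. i < n \<Longrightarrow> (\<Sum>k<r. Y $$ (i, k) * Y $$ (i, k)) = 1"
    by (auto simp: feasible_iff)
  have z2: "z $ i * z $ i = 1" if "i < n" for i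
    using z that by (auto simp: sign_vecs_def)
  define x where "x i k = z $ i * Y $$ (i, k)" for i k
  define G where "G i j = (\<Sum>k<r. x i k * x j k)" for i j
  have G1: "G i i = 1" if "i < n" for i
  proof -
    have "G i i = (\<Sum>k<r. (z $ i * z $ i) * (Y $$ (i, k) * Y $$ (i, k)))"
      by (simp add: G_def x_def algebra_simps)
    then show ?thesis using Y1 z2 that by simp
  qed
  have dist: "(\<Sum>k<r. (x i k - x j k)\<^sup>2) = 2 * (1 - G i j)" if "i < n" "j < n" for i j
  proof -
    have "(\<Sum>k<r. (x i k - x j k)\<^sup>2) = G i i + G j j - 2 * G i j"
      by (simp add: G_def power2_eq_square algebra_simps sum_distrib_left flip: sum.distrib sum_subtractf)
    then show ?thesis using G1 that by simp
  qed
  have GG: "(\<Sum>k<r. \<Sum>l<r. (x i k * x i l) * (x j k * x j l)) = (G i j)\<^sup>2" for i j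
    by (simp add: G_def power2_eq_square sum_product algebra_simps)
  have dist2: "(\<Sum>k<r. \<Sum>l<r. (x i k * x i l - x j k * x j l)\<^sup>2) = 2 * (1 - (G i j)\<^sup>2)"
    if "i < n" "j < n" for i j
  proof -
    have "(\<Sum>k<r. \<Sum>l<r. (x i k * x i l - x j k * x j l)\<^sup>2) = (\<Sum>k<r. \<Sum>l<r.
        (x i k * x i l) * (x i k * x i l) + (x j k * x j l) * (x j k * x j l)
        - 2 * ((x i k * x i l) * (x j k * x j l)))"
      by (intro sum.cong refl) (simp add: power2_eq_square algebra_simps)
    also have "\<dots> = (G i i)\<^sup>2 + (G j j)\<^sup>2 - 2 * (G i j)\<^sup>2"
      by (simp only: sum.distrib sum_subtractf GG flip: sum_distrib_left)
    finally show ?thesis using G1 that by simp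
  qed
  define sG where "sG = (\<Sum>i<n. \<Sum>j<n. G i j)"
  define sG2 where "sG2 = (\<Sum>i<n. \<Sum>j<n. (G i j)\<^sup>2)"
  have n0: "real n > 0" using n by simp

  have lower: "m * (real n - sG / n) \<le> (\<Sum>i<n. \<Sum>j<n. w {i, j} * (1 - G i j))"
  proof -
    have "(\<Sum>k<r. (\<Sum>i<n. x i k)\<^sup>2) = (\<Sum>k<r. \<Sum>i<n. \<Sum>j<n. x i k * x j k)"
      by (simp add: power2_eq_square sum_product)
    also have "\<dots> = sG"
      unfolding sG_def G_def by (rule sum_rotate3)
    finally have a: "(\<Sum>k<r. (\<Sum>i<n. x i k)\<^sup>2) = sG" .
    have b: "(\<Sum>k<r. \<Sum>i<n. (x i k)\<^sup>2) = real n"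
    proof -
      have "(\<Sum>k<r. \<Sum>i<n. (x i k)\<^sup>2) = (\<Sum>i<n. G i i)"
        unfolding G_def power2_eq_square by (rule sum.swap)
      then show ?thesis using G1 by simp
    qed
    have "m * (real n - sG / n) = (\<Sum>k<r. m * ((\<Sum>i<n. (x i k)\<^sup>2) - (\<Sum>i<n. x i k)\<^sup>2 / n))"
      by (simp add: sum_subtractf a b flip: sum_distrib_left sum_divide_distrib)
    also have "\<dots> \<le> (\<Sum>k<r. dirichlet n w (\<lambda>i. x i k))"
      by (intro sum_mono spectral_window_uncentred[OF win n])
    also have "\<dots> = (\<Sum>i<n. \<Sum>j<n. \<Sum>k<r. w {i, j} * (x i k - x j k)\<^sup>2) / 2"
      unfolding dirichlet_def sum_divide_distrib[symmetric] by (simp only: sum_rotate3[where A = "{..<r}" and B = "{..<n}" and C = "{..<n}"])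
    also have "\<dots> = (\<Sum>i<n. \<Sum>j<n. w {i, j} * (2 * (1 - G i j))) / 2"
      by (simp add: dist flip: sum_distrib_left)
    also have "\<dots> = (\<Sum>i<n. \<Sum>j<n. w {i, j} * (1 - G i j))"
      unfolding sum_divide_distrib by (intro sum.cong refl) (simp add: field_simps)
    finally show ?thesis .
  qed

  have upper: "(\<Sum>i<n. \<Sum>j<n. w {i, j} * (1 - (G i j)\<^sup>2)) \<le> M * (real n - sG2 / n)"
  proof -
    have "(\<Sum>k<r. \<Sum>l<r. (\<Sum>i<n. x i k * x i l)\<^sup>2) =
        (\<Sum>k<r. \<Sum>l<r. \<Sum>i<n. \<Sum>j<n. (x i k * x i l) * (x j k * x j l))"
      by (simp add: power2_eq_square sum_product)
    also have "\<dots> = (\<Sum>i<n. \<Sum>j<n. \<Sum>k<r. \<Sum>l<r. (x i k * x i l) * (x j k * x j l))"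
      by (rule sum_rotate4)
    also have "\<dots> = sG2" by (simp only: GG sG2_def)
    finally have a: "(\<Sum>k<r. \<Sum>l<r. (\<Sum>i<n. x i k * x i l)\<^sup>2) = sG2" .
    have b: "(\<Sum>k<r. \<Sum>l<r. \<Sum>i<n. (x i k * x i l)\<^sup>2) = real n"
    proof -
      have "(\<Sum>k<r. \<Sum>l<r. \<Sum>i<n. (x i k * x i l)\<^sup>2) = (\<Sum>i<n. \<Sum>k<r. \<Sum>l<r. (x i k * x i l)\<^sup>2)"
        by (rule sum_rotate3[symmetric])
      also have "\<dots> = (\<Sum>i<n. (G i i)\<^sup>2)"
        by (intro sum.cong refl trans[OF _ GG]) (simp add: power2_eq_square)
      finally show ?thesis using G1 by simp
    qed
    have "(\<Sum>i<n. \<Sum>j<n. w {i, j} * (1 - (G i j)\<^sup>2)) = (\<Sum>i<n. \<Sum>j<n. w {i, j} * (2 * (1 - (G i j)\<^sup>2))) / 2"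
      unfolding sum_divide_distrib by (intro sum.cong refl) (simp add: field_simps)
    also have "\<dots> = (\<Sum>i<n. \<Sum>j<n. \<Sum>k<r. \<Sum>l<r. w {i, j} * (x i k * x i l - x j k * x j l)\<^sup>2) / 2"
      by (simp add: dist2 flip: sum_distrib_left)
    also have "\<dots> = (\<Sum>k<r. \<Sum>l<r. \<Sum>i<n. \<Sum>j<n. w {i, j} * (x i k * x i l - x j k * x j l)\<^sup>2) / 2"
      by (simp only: sum_rotate4[where A = "{..<r}" and B = "{..<r}" and C = "{..<n}" and D = "{..<n}"])
    also have "\<dots> = (\<Sum>k<r. \<Sum>l<r. dirichlet n w (\<lambda>i. x i k * x i l))"
      by (simp add: dirichlet_def sum_divide_distrib)
    also have "\<dots> \<le> (\<Sum>k<r. \<Sum>l<r. M * ((\<Sum>i<n. (x i k * x i l)\<^sup>2) - (\<Sum>i<n. x i k * x i l)\<^sup>2 / n))"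
      by (intro sum_mono spectral_window_uncentred[OF win n])
    also have "\<dots> = M * (real n - sG2 / n)"
      by (simp add: sum_subtractf a b flip: sum_distrib_left sum_divide_distrib)
    finally show ?thesis .
  qed

  have Gle: "G i j \<le> 1" if "i < n" "j < n" for i j
  proof -
    have "0 \<le> (\<Sum>k<r. (x i k - x j k)\<^sup>2)" by (intro sum_nonneg) auto
    then show ?thesis using dist[OF that] by simp
  qed
  have sG_nonneg: "sG \<ge> 0"
  proof -
    have "sG = (\<Sum>k<r. (\<Sum>i<n. x i k)\<^sup>2)"
      unfolding power2_eq_square sum_product sG_def G_def by (rule sum_rotate3[symmetric])
    then show ?thesis by (simp add: sum_nonneg)
  qed
  have sG_le: "sG \<le> (real n)\<^sup>2"
  proof -
    have "sG \<le> (\<Sum>i<n. \<Sum>j<n. 1 :: real)"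
      unfolding sG_def by (intro sum_mono Gle) auto
    then show ?thesis by (simp add: power2_eq_square)
  qed
  define s where "s = sG / (real n)\<^sup>2"
  have s01: "0 \<le> s" "s \<le> 1" using sG_nonneg sG_le n0 by (auto simp: s_def)
  have sG_s: "sG = s * (real n)\<^sup>2" using n0 by (simp add: s_def)
  \<comment> \<open>The mean of the squares is at least the square of the mean.\<close>
  have cs: "s\<^sup>2 * (real n)\<^sup>2 \<le> sG2"
  proof -
    have "0 \<le> (\<Sum>i<n. \<Sum>j<n. (G i j - s)\<^sup>2)" by (intro sum_nonneg) auto
    also have "\<dots> = (\<Sum>i<n. \<Sum>j<n. (G i j)\<^sup>2 + s\<^sup>2 - 2 * s * G i j)"
      by (simp add: power2_diff algebra_simps)
    also have "\<dots> = sG2 + (real n)\<^sup>2 * s\<^sup>2 - 2 * s * sG"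
      by (simp add: sum.distrib sum_subtractf sG_def sG2_def power2_eq_square mult.assoc
          flip: sum_distrib_left)
    finally show ?thesis by (simp add: sG_s power2_eq_square algebra_simps)
  qed
  have "(real r - 1) * (m * (real n - sG / n)) \<le> (real r - 1) * (\<Sum>i<n. \<Sum>j<n. w {i, j} * (1 - G i j))"
    using lower r1 by (intro mult_left_mono) auto
  also have "\<dots> \<le> (\<Sum>i<n. \<Sum>j<n. w {i, j} * (1 - (G i j)\<^sup>2))"
    using second_order_averaged[OF z C crit] by (simp add: G_def x_def)
  also have "\<dots> \<le> M * (real n - sG2 / n)" by (rule upper)
  also have "\<dots> \<le> M * (real n - (s\<^sup>2 * (real n)\<^sup>2) / n)"
    using M cs n0 by (intro mult_left_mono diff_left_mono divide_right_mono) auto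
  also have "\<dots> = real n * (M * ((1 - s) * (1 + s)))"
    using n0 by (simp add: field_simps power2_eq_square)
  also have "\<dots> \<le> real n * (M * ((1 - s) * 2))"
    using M s01 n0 by (intro mult_left_mono) auto
  finally have "real n * ((1 - s) * ((real r - 1) * m)) \<le> real n * ((1 - s) * (2 * M))"
    using n0 by (simp add: sG_s field_simps power2_eq_square)
  then have "(1 - s) * ((real r - 1) * m) \<le> (1 - s) * (2 * M)" using n0 by simp
  with r s01 have "s = 1"
    by (metis diff_gt_0_iff_gt mult_le_cancel_left_pos not_less order_le_less)
  then have "(\<Sum>i<n. \<Sum>j<n. 1 - G i j) = 0"
    using sG_s by (simp add: sum_subtractf sG_def power2_eq_square)
  then have "(\<Sum>j<n. 1 - G 0 j) = 0"
    using n Gle by (subst (asm) sum_nonneg_eq_0_iff) (auto intro!: sum_nonneg)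
  then have "G 0 i = 1" if "i < n" for i
    using that n Gle by (subst (asm) sum_nonneg_eq_0_iff) auto
  then have "(\<Sum>k<r. (x 0 k - x i k)\<^sup>2) = 0" if "i < n" for i
    using dist[OF n that] that by simp
  then have eq: "x i k = x 0 k" if "i < n" "k < r" for i k
    using that by (auto simp: sum_nonneg_eq_0_iff)
  define u where "u = vec r (x 0)"
  have "u \<bullet> u = G 0 0" by (simp add: u_def scalar_prod_def G_def atLeast0LessThan)
  then have "u \<bullet> u = 1" using G1[OF n] by simp
  moreover have "Y = outer_prod z u"
  proof (rule eq_matI)
    have dz: "dim_vec z = n" using z by (auto simp: sign_vecs_def)
    show "dim_row Y = dim_row (outer_prod z u)" "dim_col Y = dim_col (outer_prod z u)"
      using Y dz by (auto simp: outer_prod_def u_def)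
    fix i k assume "i < dim_row (outer_prod z u)" "k < dim_col (outer_prod z u)"
    then have ik: "i < n" "k < r" using dz by (auto simp: outer_prod_def u_def)
    have "z $ i * x i k = Y $$ (i, k)"
      using z2[OF ik(1)] by (simp add: x_def flip: mult.assoc)
    then show "Y $$ (i, k) = outer_prod z u $$ (i, k)"
      using ik dz eq[OF ik] by (simp add: outer_prod_def u_def)
  qed
  ultimately show ?thesis by (auto simp: u_def)
qed

section \<open>A spectral window from regularity of the signed graph\<close>
abbreviation pairs :: "nat \<Rightarrow> nat set set" where "pairs n \<equiv> [{..<n}]\<^bsup>2\<^esup>"

lemma finite_pairs [simp]: "finite (pairs n)"
  by (simp add: finite_imp_finite_nsets)

lemma pairs_Suc: "pairs (Suc n) = pairs n \<union> (\<lambda>i. {i, n}) ` {..<n}"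
proof (intro equalityI Un_least subsetI)
  fix e assume "e \<in> pairs (Suc n)"
  then obtain x y where xy: "e = {x, y}" "x < Suc n" "y < Suc n" "x \<noteq> y" by (auto simp: nsets_2_eq)
  then consider "x < n" "y < n" | "y = n" "x < n" | "x = n" "y < n" by linarith
  then show "e \<in> pairs n \<union> (\<lambda>i. {i, n}) ` {..<n}"
    using xy by cases (auto simp: insert_commute)
qed (use nsets_mono[of "{..<n}" "{..<Suc n}" 2] in auto)

lemma sum_ordered_pairs:
  fixes F :: "nat set \<Rightarrow> real"
  shows "(\<Sum>i<n. \<Sum>j<n. if i \<noteq> j then F {i, j} else 0) = 2 * (\<Sum>e\<in>pairs n. F e)"
proof (induction n)
  case 0
  then show ?case by (simp add: nsets_empty_iff)
next
  case (Suc n)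
  have "inj_on (\<lambda>i. {i, n}) {..<n}" by (auto simp: inj_on_def doubleton_eq_iff)
  moreover have "pairs n \<inter> (\<lambda>i. {i, n}) ` {..<n} = {}" by (auto simp: nsets_def)
  ultimately have e: "(\<Sum>e\<in>pairs (Suc n). F e) = (\<Sum>e\<in>pairs n. F e) + (\<Sum>i<n. F {i, n})"
    unfolding pairs_Suc by (subst sum.union_disjoint) (auto simp: sum.reindex)
  have "(\<Sum>i<Suc n. \<Sum>j<Suc n. if i \<noteq> j then F {i, j} else 0) =
     (\<Sum>i<n. \<Sum>j<n. if i \<noteq> j then F {i, j} else 0) + (\<Sum>i<n. F {i, n}) + (\<Sum>j<n. F {n, j})"
    by (simp add: sum.distrib)
  then show ?case using Suc e by (simp add: insert_commute)
qed

definition vertex_weight :: "nat \<Rightarrow> (nat set \<Rightarrow> real) \<Rightarrow> nat \<Rightarrow> real" where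
  "vertex_weight n w v = (\<Sum>e\<in>{e \<in> pairs n. v \<in> e}. w e)"

lemma sum_incidences:
  "(\<Sum>e\<in>pairs n. w e * (\<Sum>k\<in>e. g k)) = (\<Sum>v<n. g v * vertex_weight n w v)"
proof -
  have "(\<Sum>e\<in>pairs n. w e * (\<Sum>k\<in>e. g k)) = (\<Sum>e\<in>pairs n. \<Sum>v\<in>{v \<in> {..<n}. v \<in> e}. w e * g v)"
    by (intro sum.cong refl) (auto simp: sum_distrib_left nsets_def intro!: sum.cong)
  also have "\<dots> = (\<Sum>v<n. \<Sum>e\<in>{e \<in> pairs n. v \<in> e}. w e * g v)"
    by (rule sum.swap_restrict) auto
  also have "\<dots> = (\<Sum>v<n. g v * vertex_weight n w v)"
    by (simp add: vertex_weight_def sum_distrib_left mult.commute)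
  finally show ?thesis .
qed

lemma square_sum_pairs:
  fixes f :: "nat \<Rightarrow> real"
  shows "(\<Sum>i<n. f i)\<^sup>2 = (\<Sum>i<n. (f i)\<^sup>2) + 2 * (\<Sum>e\<in>pairs n. \<Prod>k\<in>e. f k)"
proof -
  have "(\<Sum>i<n. f i)\<^sup>2 = (\<Sum>i<n. \<Sum>j<n. f i * f j)"
    by (simp add: power2_eq_square sum_product)
  also have "\<dots> = (\<Sum>i<n. \<Sum>j<n. (if i = j then (f i)\<^sup>2 else 0) + (if i \<noteq> j then (\<Prod>k\<in>{i, j}. f k) else 0))"
    by (intro sum.cong refl) (auto simp: power2_eq_square)
  also have "\<dots> = (\<Sum>i<n. (f i)\<^sup>2) + 2 * (\<Sum>e\<in>pairs n. \<Prod>k\<in>e. f k)"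
    by (simp only: sum.distrib sum_ordered_pairs) simp
  finally show ?thesis .
qed

lemma dirichlet_pairs:
  "dirichlet n w f = (\<Sum>e\<in>pairs n. w e * (\<Sum>k\<in>e. (f k)\<^sup>2)) - 2 * (\<Sum>e\<in>pairs n. w e * (\<Prod>k\<in>e. f k))"
proof -
  have "dirichlet n w f = (\<Sum>i<n. \<Sum>j<n. if i \<noteq> j
      then w {i, j} * (\<Sum>k\<in>{i, j}. (f k)\<^sup>2) - 2 * (w {i, j} * (\<Prod>k\<in>{i, j}. f k)) else 0) / 2"
    unfolding dirichlet_def
    by (intro arg_cong[where f = "\<lambda>t. t / 2"] sum.cong refl) (auto simp: power2_eq_square algebra_simps)
  also have "\<dots> = (\<Sum>e\<in>pairs n. w e * (\<Sum>k\<in>e. (f k)\<^sup>2) - 2 * (w e * (\<Prod>k\<in>e. f k)))"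
    by (subst sum_ordered_pairs) simp
  also have "\<dots> = (\<Sum>e\<in>pairs n. w e * (\<Sum>k\<in>e. (f k)\<^sup>2)) - 2 * (\<Sum>e\<in>pairs n. w e * (\<Prod>k\<in>e. f k))"
    by (simp add: sum_subtractf sum_distrib_left)
  finally show ?thesis .
qed

lemma pair_prod_le_sum_squares:
  fixes f :: "nat \<Rightarrow> real"
  assumes "e \<in> pairs n"
  shows "2 * \<bar>\<Prod>k\<in>e. f k\<bar> \<le> (\<Sum>k\<in>e. (f k)\<^sup>2)"
proof -
  from assms obtain i j where e: "e = {i, j}" "i \<noteq> j" by (auto simp: nsets_2_eq)
  have "0 \<le> (\<bar>f i\<bar> - \<bar>f j\<bar>)\<^sup>2" by simp
  then show ?thesis using e by (simp add: power2_diff abs_mult)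
qed

lemma dirichlet_le_degree:
  assumes deg: "\<And>v. v < n \<Longrightarrow> vertex_weight n (\<lambda>e. \<bar>w e\<bar>) v \<le> D"
  shows "dirichlet n w f \<le> 2 * D * (\<Sum>i<n. (f i)\<^sup>2)"
proof -
  have "dirichlet n w f = (\<Sum>e\<in>pairs n. w e * ((\<Sum>k\<in>e. (f k)\<^sup>2) - 2 * (\<Prod>k\<in>e. f k)))"
    by (simp add: dirichlet_pairs sum_distrib_left algebra_simps flip: sum_subtractf)
  also have "\<dots> \<le> (\<Sum>e\<in>pairs n. \<bar>w e\<bar> * (2 * (\<Sum>k\<in>e. (f k)\<^sup>2)))"
  proof (rule sum_mono)
    fix e assume e: "e \<in> pairs n"
    have "w e * ((\<Sum>k\<in>e. (f k)\<^sup>2) - 2 * (\<Prod>k\<in>e. f k)) \<le> \<bar>w e\<bar> * \<bar>(\<Sum>k\<in>e. (f k)\<^sup>2) - 2 * (\<Prod>k\<in>e. f k)\<bar>"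
      by (metis abs_ge_self abs_mult)
    also have "\<dots> \<le> \<bar>w e\<bar> * (2 * (\<Sum>k\<in>e. (f k)\<^sup>2))"
      using pair_prod_le_sum_squares[OF e, of f] by (intro mult_left_mono) auto
    finally show "w e * ((\<Sum>k\<in>e. (f k)\<^sup>2) - 2 * (\<Prod>k\<in>e. f k)) \<le> \<bar>w e\<bar> * (2 * (\<Sum>k\<in>e. (f k)\<^sup>2))" .
  qed
  also have "\<dots> = 2 * (\<Sum>v<n. (f v)\<^sup>2 * vertex_weight n (\<lambda>e. \<bar>w e\<bar>) v)"
    by (simp add: sum_distrib_left mult.left_commute flip: sum_incidences)
  also have "\<dots> \<le> 2 * (\<Sum>v<n. (f v)\<^sup>2 * D)"
    by (intro mult_left_mono sum_mono deg) auto
  finally show ?thesis by (simp add: sum_distrib_left algebra_simps)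
qed

definition pair_form :: "nat \<Rightarrow> (nat set \<Rightarrow> real) \<Rightarrow> (nat \<Rightarrow> real) \<Rightarrow> real" where
  "pair_form n c x = (\<Sum>e\<in>pairs n. c e * (\<Prod>k\<in>e. x k))"

text \<open>
  A two-element set contains a vertex at most once: the form is multilinear.
\<close>
lemma pair_form_affine: "\<exists>A B. \<forall>t. pair_form n c (x(v := t)) = A + B * t"
proof (intro exI allI)
  fix t
  have fin: "finite e" if "e \<in> pairs n" for e using that by (simp add: nsets_def)
  have "pair_form n c (x(v := t)) = (\<Sum>e\<in>pairs n. (if v \<in> e then 0 else c e * (\<Prod>k\<in>e. x k))
      + (if v \<in> e then c e * (\<Prod>k\<in>e - {v}. x k) else 0) * t)"
    unfolding pair_form_def
  proof (intro sum.cong refl)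
    fix e assume e: "e \<in> pairs n"
    show "c e * (\<Prod>k\<in>e. (x(v := t)) k) = (if v \<in> e then 0 else c e * (\<Prod>k\<in>e. x k))
      + (if v \<in> e then c e * (\<Prod>k\<in>e - {v}. x k) else 0) * t"
    proof (cases "v \<in> e")
      case True
      have "(\<Prod>k\<in>e - {v}. (x(v := t)) k) = (\<Prod>k\<in>e - {v}. x k)" by (intro prod.cong) auto
      then have "(\<Prod>k\<in>e. (x(v := t)) k) = t * (\<Prod>k\<in>e - {v}. x k)"
        using prod.remove[OF fin[OF e] True, of "x(v := t)"] by simp
      then show ?thesis using True by simp
    next
      case False
      have "(\<Prod>k\<in>e. (x(v := t)) k) = (\<Prod>k\<in>e. x k)" using False by (intro prod.cong) auto
      then show ?thesis using False by simp
    qed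
  qed
  also have "\<dots> = (\<Sum>e\<in>pairs n. if v \<in> e then 0 else c e * (\<Prod>k\<in>e. x k))
      + (\<Sum>e\<in>pairs n. if v \<in> e then c e * (\<Prod>k\<in>e - {v}. x k) else 0) * t"
    by (simp add: sum.distrib sum_distrib_right)
  finally show "pair_form n c (x(v := t)) = (\<Sum>e\<in>pairs n. if v \<in> e then 0 else c e * (\<Prod>k\<in>e. x k))
      + (\<Sum>e\<in>pairs n. if v \<in> e then c e * (\<Prod>k\<in>e - {v}. x k) else 0) * t" .
qed

text \<open>
  An affine function on an interval is largest at an endpoint, so the coordinates can be moved to
  neighbouring integers one after the other.
\<close>
lemma pair_form_rounding:
  "\<exists>m :: nat \<Rightarrow> int. (\<forall>k<n. \<bar>m k - x k\<bar> \<le> 1) \<and> pair_form n c x \<le> pair_form n c (\<lambda>k. m k)"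
proof -
  have "\<exists>y. (\<forall>k<N. y k \<in> \<int> \<and> \<bar>y k - x k\<bar> \<le> 1) \<and> (\<forall>k\<ge>N. y k = x k) \<and> pair_form n c x \<le> pair_form n c y" for N
  proof (induction N)
    case 0
    then show ?case by auto
  next
    case (Suc N)
    then obtain y where y: "\<forall>k<N. y k \<in> \<int> \<and> \<bar>y k - x k\<bar> \<le> 1" "\<forall>k\<ge>N. y k = x k"
      "pair_form n c x \<le> pair_form n c y" by blast
    obtain A B where AB: "\<And>t. pair_form n c (y(N := t)) = A + B * t"
      using pair_form_affine[of n c y N] by blast
    define t where "t = (if B \<ge> 0 then of_int \<lceil>x N\<rceil> else of_int \<lfloor>x N\<rfloor> :: real)"
    have "B * y N \<le> B * t"
      using y(2) by (auto simp: t_def mult_left_mono mult_left_mono_neg)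
    then have "pair_form n c y \<le> pair_form n c (y(N := t))"
      using AB[of t] AB[of "y N"] by simp
    with y(3) have up: "pair_form n c x \<le> pair_form n c (y(N := t))" by linarith
    have "t \<in> \<int>" "\<bar>t - x N\<bar> \<le> 1" by (auto simp: t_def) linarith+
    then show ?case
      using y up by (intro exI[of _ "y(N := t)"] conjI up) (auto simp: less_Suc_eq)
  qed
  from this[of n] obtain y where y: "\<forall>k<n. y k \<in> \<int> \<and> \<bar>y k - x k\<bar> \<le> 1"
    "pair_form n c x \<le> pair_form n c y" by blast
  define m where "m k = \<lfloor>y k\<rfloor>" for k
  have m: "real_of_int (m k) = y k" if "k < n" for k
    using y(1) that by (auto simp: m_def elim!: Ints_cases)
  have "pair_form n c y = pair_form n c (\<lambda>k. m k)"
    unfolding pair_form_def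
    by (intro sum.cong refl arg_cong2[where f = "(*)"] prod.cong) (auto simp: m nsets_def)
  with y m show ?thesis by (intro exI[of _ m]) auto
qed

text \<open>
  A heavy pair whose two entries differ by more than a factor \<open>\<gamma>\<close> costs only
  \<open>\<gamma> (m\<^sub>i\<^sup>2 + m\<^sub>j\<^sup>2)\<close>, which the degrees control. If the entries are comparable, both squares exceed
  \<open>\<gamma> h\<close>, so both ends lie in a small set. In that case \<open>|m\<^sub>i m\<^sub>j| \<le> min (m\<^sub>i\<^sup>2) (m\<^sub>j\<^sup>2) / \<gamma>\<close>, and the
  minimum is a sum over the levels \<open>t\<close> of the indicators of \<open>{i, j} \<subseteq> H t\<close>, where \<open>H t\<close> is a superlevel set
  of the squares. Each level set is small, hence spans weight at most \<open>\<rho> card (H t)\<close>, and the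
  cardinalities add up to the sum of the squares again.
\<close>
lemma heavy_pairs_bound:
  fixes a :: "nat set \<Rightarrow> real" and m :: "nat \<Rightarrow> int" and \<rho> \<gamma> h Q D :: real
  assumes a: "\<And>e. a e \<ge> 0"
    and deg: "\<And>v. v < n \<Longrightarrow> vertex_weight n a v \<le> D"
    and sparse: "\<And>T. T \<subseteq> {..<n} \<Longrightarrow> real (card T) \<le> Q / (\<gamma> * h)
      \<Longrightarrow> (\<Sum>e\<in>{e \<in> pairs n. e \<subseteq> T}. a e) \<le> \<rho> * card T"
    and \<rho>: "\<rho> \<ge> 0" and \<gamma>: "0 < \<gamma>" "\<gamma> \<le> 1" and h: "h > 0"
    and Q: "(\<Sum>k<n. (real_of_int (m k))\<^sup>2) \<le> Q" and D: "D \<ge> 0"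
  shows "(\<Sum>e\<in>{e \<in> pairs n. \<bar>\<Prod>k\<in>e. real_of_int (m k)\<bar> > h}. a e * \<bar>\<Prod>k\<in>e. real_of_int (m k)\<bar>)
    \<le> (\<gamma> * D + \<rho> / \<gamma>) * Q"
proof -
  define q where "q k = nat ((m k)\<^sup>2)" for k
  have q: "real (q k) = (real_of_int (m k))\<^sup>2" for k by (simp add: q_def)
  define N where "N = (\<Sum>k<n. q k)"
  have qN: "q k \<le> N" if "k < n" for k
    unfolding N_def using that by (intro member_le_sum) auto
  define H where "H t = {k. k < n \<and> t \<le> q k \<and> \<gamma> * h < q k}" for t :: nat
  have cardH: "real (card (H t)) \<le> Q / (\<gamma> * h)" for t
  proof -
    have "real (card (H t)) * (\<gamma> * h) = (\<Sum>k\<in>H t. \<gamma> * h)" by simp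
    also have "\<dots> \<le> (\<Sum>k\<in>H t. real (q k))" by (intro sum_mono) (auto simp: H_def)
    also have "\<dots> \<le> (\<Sum>k<n. real (q k))" by (intro sum_mono2) (auto simp: H_def)
    also have "\<dots> \<le> Q" using Q by (simp add: q)
    finally show ?thesis using \<gamma> h by (simp add: field_simps)
  qed
  have pointwise: "\<bar>\<Prod>k\<in>e. real_of_int (m k)\<bar> \<le>
      \<gamma> * (\<Sum>k\<in>e. (real_of_int (m k))\<^sup>2) + (\<Sum>t=1..N. if e \<subseteq> H t then 1 else 0) / \<gamma>"
    if e: "e \<in> pairs n" and heavy: "\<bar>\<Prod>k\<in>e. real_of_int (m k)\<bar> > h" for e
  proof -
    from e obtain i' j' where ij': "e = {i', j'}" "i' \<noteq> j'" "i' < n" "j' < n"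
      by (auto simp: nsets_2_eq)
    then obtain i j where ij: "e = {i, j}" "i \<noteq> j" "i < n" "j < n" "\<bar>m j\<bar> \<le> \<bar>m i\<bar>"
      by (metis insert_commute linear)
    define s t where "s = real_of_int \<bar>m i\<bar>" and "t = real_of_int \<bar>m j\<bar>"
    have st: "0 \<le> t" "t \<le> s" using ij by (auto simp: s_def t_def)
    have pr: "\<bar>\<Prod>k\<in>e. real_of_int (m k)\<bar> = s * t" using ij by (simp add: s_def t_def abs_mult)
    have sq: "(\<Sum>k\<in>e. (real_of_int (m k))\<^sup>2) = s\<^sup>2 + t\<^sup>2" using ij by (simp add: s_def t_def)
    have qs: "real (q i) = s\<^sup>2" "real (q j) = t\<^sup>2" by (simp_all add: q s_def t_def)
    show ?thesis
    proof (cases "t \<le> \<gamma> * s")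
      case True
      have "s * t \<le> s * (\<gamma> * s)" using True st by (intro mult_left_mono) auto
      also have "\<dots> \<le> \<gamma> * (s\<^sup>2 + t\<^sup>2)" using \<gamma> by (simp add: power2_eq_square algebra_simps)
      finally have "s * t \<le> \<gamma> * (s\<^sup>2 + t\<^sup>2)" .
      moreover have "0 \<le> (\<Sum>u=1..N. if e \<subseteq> H u then 1 else 0) / \<gamma>"
        using \<gamma> by (intro divide_nonneg_pos sum_nonneg) auto
      ultimately show ?thesis using pr sq by simp
    next
      case False
      have "\<gamma> * (s * t) = (\<gamma> * s) * t" by simp
      also have "\<dots> \<le> t * t" using False st by (intro mult_right_mono) auto
      finally have gst: "\<gamma> * (s * t) \<le> t * t" .
      have "\<gamma> * h < \<gamma> * (s * t)" using heavy pr \<gamma> by simp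
      also note gst
      finally have ht: "\<gamma> * h < t\<^sup>2" by (simp add: power2_eq_square)
      have ts: "t\<^sup>2 \<le> s\<^sup>2" using st by (intro power_mono) auto
      have "{1..q j} \<subseteq> {u \<in> {1..N}. e \<subseteq> H u}"
      proof
        fix u assume u: "u \<in> {1..q j}"
        then have "real u \<le> real (q j)" by simp
        then have "real u \<le> real (q i)" using qs ts by simp
        then have "u \<le> q i" by simp
        then show "u \<in> {u \<in> {1..N}. e \<subseteq> H u}"
          using u ij ht ts qs qN[OF ij(4)] by (auto simp: H_def)
      qed
      then have "card {1..q j} \<le> card {u \<in> {1..N}. e \<subseteq> H u}" by (intro card_mono) auto
      then have "t\<^sup>2 \<le> real (card {u \<in> {1..N}. e \<subseteq> H u})" using qs(2) by simp
      also have "\<dots> = (\<Sum>u=1..N. if e \<subseteq> H u then 1 else 0)"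
        by (simp add: sum.If_cases Int_def)
      finally have c: "t\<^sup>2 \<le> (\<Sum>u=1..N. if e \<subseteq> H u then 1 else 0)" .
      have "s * t \<le> t\<^sup>2 / \<gamma>"
        using gst \<gamma> by (simp add: field_simps power2_eq_square)
      also have "\<dots> \<le> (\<Sum>u=1..N. if e \<subseteq> H u then 1 else 0) / \<gamma>"
        using c \<gamma> by (intro divide_right_mono) auto
      finally have "s * t \<le> (\<Sum>u=1..N. if e \<subseteq> H u then 1 else 0) / \<gamma>" .
      moreover have "0 \<le> \<gamma> * (s\<^sup>2 + t\<^sup>2)" using \<gamma> by simp
      ultimately show ?thesis unfolding pr sq by linarith
    qed
  qed
  have "(\<Sum>e\<in>{e \<in> pairs n. \<bar>\<Prod>k\<in>e. real_of_int (m k)\<bar> > h}. a e * \<bar>\<Prod>k\<in>e. real_of_int (m k)\<bar>)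
    \<le> (\<Sum>e\<in>{e \<in> pairs n. \<bar>\<Prod>k\<in>e. real_of_int (m k)\<bar> > h}. a e *
      (\<gamma> * (\<Sum>k\<in>e. (real_of_int (m k))\<^sup>2) + (\<Sum>t=1..N. if e \<subseteq> H t then 1 else 0) / \<gamma>))"
    by (intro sum_mono mult_left_mono pointwise a) auto
  also have "\<dots> \<le> (\<Sum>e\<in>pairs n. a e *
      (\<gamma> * (\<Sum>k\<in>e. (real_of_int (m k))\<^sup>2) + (\<Sum>t=1..N. if e \<subseteq> H t then 1 else 0) / \<gamma>))"
    using a \<gamma> by (intro sum_mono2) (auto intro!: mult_nonneg_nonneg add_nonneg_nonneg sum_nonneg divide_nonneg_nonneg)
  also have "\<dots> = \<gamma> * (\<Sum>e\<in>pairs n. a e * (\<Sum>k\<in>e. (real_of_int (m k))\<^sup>2))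
      + (\<Sum>e\<in>pairs n. \<Sum>t=1..N. a e * (if e \<subseteq> H t then 1 else 0)) / \<gamma>"
    by (simp add: distrib_left sum.distrib sum_distrib_left sum_divide_distrib mult.left_commute)
  also have "(\<Sum>e\<in>pairs n. \<Sum>t=1..N. a e * (if e \<subseteq> H t then 1 else 0)) =
      (\<Sum>t=1..N. \<Sum>e\<in>{e \<in> pairs n. e \<subseteq> H t}. a e)"
    by (subst sum.swap) (auto simp: sum.inter_filter if_distrib[of "\<lambda>x. _ * x"] cong: if_cong intro!: sum.cong)
  also have "\<gamma> * (\<Sum>e\<in>pairs n. a e * (\<Sum>k\<in>e. (real_of_int (m k))\<^sup>2)) \<le> \<gamma> * (D * Q)"
  proof (intro mult_left_mono)
    have "(\<Sum>e\<in>pairs n. a e * (\<Sum>k\<in>e. (real_of_int (m k))\<^sup>2)) = (\<Sum>v<n. (real_of_int (m v))\<^sup>2 * vertex_weight n a v)"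
      by (rule sum_incidences)
    also have "\<dots> \<le> (\<Sum>v<n. (real_of_int (m v))\<^sup>2 * D)"
      by (intro sum_mono mult_left_mono deg) auto
    also have "\<dots> \<le> D * Q"
      using mult_left_mono[OF Q D] by (simp add: sum_distrib_left mult.commute)
    finally show "(\<Sum>e\<in>pairs n. a e * (\<Sum>k\<in>e. (real_of_int (m k))\<^sup>2)) \<le> D * Q" .
  qed (use \<gamma> in auto)
  also have "(\<Sum>t=1..N. \<Sum>e\<in>{e \<in> pairs n. e \<subseteq> H t}. a e) \<le> (\<Sum>t=1..N. \<rho> * card (H t))"
    by (intro sum_mono sparse cardH) (auto simp: H_def)
  also have "\<dots> \<le> (\<Sum>t=1..N. \<rho> * card {k \<in> {..<n}. t \<le> q k})"
    using \<rho> by (intro sum_mono mult_left_mono of_nat_mono card_mono) (auto simp: H_def)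
  also have "\<dots> = \<rho> * (\<Sum>t=1..N. \<Sum>k\<in>{k \<in> {..<n}. t \<le> q k}. 1)"
    by (simp add: sum_distrib_left)
  also have "(\<Sum>t=1..N. \<Sum>k\<in>{k \<in> {..<n}. t \<le> q k}. 1 :: real) = (\<Sum>k<n. \<Sum>t\<in>{t \<in> {1..N}. t \<le> q k}. 1)"
    by (rule sum.swap_restrict) auto
  also have "\<dots> = (\<Sum>k<n. real (q k))"
  proof (intro sum.cong refl)
    fix k assume "k \<in> {..<n}"
    then have "{t \<in> {1..N}. t \<le> q k} = {1..q k}" using qN[of k] by auto
    then show "(\<Sum>t\<in>{t \<in> {1..N}. t \<le> q k}. 1) = real (q k)" by simp
  qed
  also have "\<rho> * \<dots> \<le> \<rho> * Q" using Q \<rho> by (intro mult_left_mono) (auto simp: q)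
  finally show ?thesis using \<gamma> by (simp add: algebra_simps divide_right_mono)
qed


text \<open>
  The radius admits every rounding of a vector \<open>x\<close> of squared norm \<open>n\<close>, since moving a coordinate by at
  most \<open>1\<close> gives \<open>m\<^sub>k\<^sup>2 \<le> 2 x\<^sub>k\<^sup>2 + 2\<close>. Extensionality makes the set finite.
\<close>
definition int_vectors :: "nat \<Rightarrow> (nat \<Rightarrow> int) set" where
  "int_vectors n = {m \<in> extensional {..<n}. (\<Sum>k<n. (m k)\<^sup>2) \<le> 4 * int n}"

definition light_pairs :: "nat \<Rightarrow> real \<Rightarrow> (nat \<Rightarrow> int) \<Rightarrow> nat set set" where
  "light_pairs n h m = {e \<in> pairs n. \<bar>\<Prod>k\<in>e. real_of_int (m k)\<bar> \<le> h}"

lemma sum_squared_pair_products: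
  fixes f :: "nat \<Rightarrow> real"
  shows "2 * (\<Sum>e\<in>pairs n. (\<Prod>k\<in>e. f k)\<^sup>2) \<le> (\<Sum>k<n. (f k)\<^sup>2)\<^sup>2"
proof -
  have "(\<Sum>k<n. (f k)\<^sup>2)\<^sup>2 = (\<Sum>k<n. ((f k)\<^sup>2)\<^sup>2) + 2 * (\<Sum>e\<in>pairs n. (\<Prod>k\<in>e. f k)\<^sup>2)"
    using square_sum_pairs[of "\<lambda>k. (f k)\<^sup>2" n] by (simp add: prod_power_distrib)
  moreover have "0 \<le> (\<Sum>k<n. ((f k)\<^sup>2)\<^sup>2)" by (intro sum_nonneg) auto
  ultimately show ?thesis by linarith
qed

text \<open>
  By homogeneity \<open>x\<close> may be scaled to squared norm \<open>n\<close>, the scale at which rounding to integers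
  changes the norm by a bounded factor only.
\<close>
lemma pair_form_bound_of_int_vectors:
  fixes b :: real
  assumes bound: "\<And>m. m \<in> int_vectors n \<Longrightarrow> pair_form n c (\<lambda>k. m k) \<le> b * n" and n: "n > 0"
  shows "pair_form n c x \<le> b * (\<Sum>k<n. (x k)\<^sup>2)"
proof (cases "(\<Sum>k<n. (x k)\<^sup>2) = 0")
  case True
  then have "x k = 0" if "k < n" for k using that by (auto simp: sum_nonneg_eq_0_iff)
  then have "pair_form n c x = pair_form n c (\<lambda>k. 0)"
    unfolding pair_form_def by (intro sum.cong refl arg_cong2[where f = "(*)"] prod.cong) (auto simp: nsets_def)
  also have "\<dots> = 0" unfolding pair_form_def by (intro sum.neutral) (auto simp: nsets_def)
  finally show ?thesis using True by simp
next
  case False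
  define S where "S = (\<Sum>k<n. (x k)\<^sup>2)"
  have S: "S > 0" unfolding S_def using False by (simp add: order.not_eq_order_implies_strict sum_nonneg)
  define s where "s = sqrt (n / S)"
  have s2: "s\<^sup>2 = n / S" using S by (simp add: s_def)
  define y where "y k = s * x k" for k
  have "(\<Sum>k<n. (y k)\<^sup>2) = s\<^sup>2 * S"
    by (simp add: y_def power_mult_distrib S_def sum_distrib_left)
  then have y2: "(\<Sum>k<n. (y k)\<^sup>2) = n" using S s2 by simp
  have "pair_form n c y = (\<Sum>e\<in>pairs n. s\<^sup>2 * (c e * (\<Prod>k\<in>e. x k)))"
    unfolding pair_form_def y_def by (intro sum.cong refl) (auto simp: prod.distrib nsets_def)
  then have scale: "pair_form n c y = s\<^sup>2 * pair_form n c x"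
    by (simp add: pair_form_def sum_distrib_left)
  obtain m0 :: "nat \<Rightarrow> int" where m0: "\<forall>k<n. \<bar>m0 k - y k\<bar> \<le> 1" "pair_form n c y \<le> pair_form n c (\<lambda>k. m0 k)"
    using pair_form_rounding by blast
  define m where "m = restrict m0 {..<n}"
  have m: "m k = m0 k" if "k < n" for k using that by (simp add: m_def)
  have "(\<Sum>k<n. (real_of_int (m k))\<^sup>2) \<le> (\<Sum>k<n. 2 * (y k)\<^sup>2 + 2)"
  proof (rule sum_mono)
    fix k assume "k \<in> {..<n}"
    then have "\<bar>m k - y k\<bar> \<le> 1" using m0 m by simp
    then have "(m k - y k)\<^sup>2 \<le> 1" by (simp add: abs_square_le_1)
    moreover have "0 \<le> (2 * y k - m k)\<^sup>2" by simp
    ultimately show "(real_of_int (m k))\<^sup>2 \<le> 2 * (y k)\<^sup>2 + 2"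
      by (simp add: power2_eq_square algebra_simps)
  qed
  also have "\<dots> = 4 * n" using y2 by (simp add: sum.distrib flip: sum_distrib_left)
  finally have "real_of_int (\<Sum>k<n. (m k)\<^sup>2) \<le> real_of_int (4 * int n)" by simp
  then have "m \<in> int_vectors n"
    unfolding int_vectors_def of_int_le_iff by (auto simp: m_def)
  from bound[OF this] have "pair_form n c (\<lambda>k. m k) \<le> b * n" .
  moreover have "pair_form n c (\<lambda>k. m k) = pair_form n c (\<lambda>k. m0 k)"
    unfolding pair_form_def
    by (intro sum.cong refl arg_cong2[where f = "(*)"] prod.cong) (auto simp: m nsets_def)
  ultimately have "s\<^sup>2 * pair_form n c x \<le> b * n" using m0(2) scale by simp
  then have "n * pair_form n c x \<le> n * (b * S)" using S by (simp add: s2 field_simps)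
  then show ?thesis using n by (simp add: S_def)
qed

text \<open>
  The deterministic conditions on the weights, with \<open>l\<close> in the role of \<open>ln n\<close> and \<open>\<mu>\<close> in that of the
  mean weight. On vectors with sum zero the constant matrix \<open>\<mu>\<close> has a nonpositive pair form, so
  centring the weights can only help. The numerical conditions make the light part, the mean over the
  heavy pairs, and the two terms of \<open>heavy_pairs_bound\<close> add up to \<open>c l n / 4\<close>, half of what the
  signed degrees provide.
\<close>
lemma spectral_window_of_regular:
  fixes w :: "nat set \<Rightarrow> real" and l a c K \<mu> \<tau> \<gamma> \<theta> :: real
  assumes n: "n > 0" and l: "l > 0" and \<mu>: "\<mu> \<ge> 0" "\<mu> * n \<le> a * l"
    and deg: "\<And>v. v < n \<Longrightarrow> vertex_weight n (\<lambda>e. \<bar>w e\<bar>) v \<le> K * l"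
    and signed: "\<And>v. v < n \<Longrightarrow> c * l \<le> vertex_weight n w v"
    and light: "\<And>m. m \<in> int_vectors n \<Longrightarrow>
      (\<Sum>e\<in>light_pairs n (\<tau> * l) m. (w e - \<mu>) * (\<Prod>k\<in>e. real_of_int (m k))) \<le> c / 16 * l * n"
    and sparse: "\<And>T. T \<subseteq> {..<n} \<Longrightarrow> real (card T) \<le> 4 * real n / (\<gamma> * (\<tau> * l)) \<Longrightarrow>
      (\<Sum>e\<in>{e \<in> pairs n. e \<subseteq> T}. \<bar>w e\<bar>) \<le> \<theta> * l * card T"
    and pos: "K > 0" "\<tau> > 0" "\<gamma> > 0" "\<gamma> \<le> 1" "\<theta> > 0"
    and \<gamma>: "\<gamma> * K \<le> c / 64" and \<theta>: "\<theta> / \<gamma> \<le> c / 64" and al: "8 * a \<le> c / 16 * \<tau> * l"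
  shows "spectral_window n w (c / 2 * l) (2 * K * l)"
proof -
  have h: "\<tau> * l > 0" using pos l by simp
  have form: "pair_form n (\<lambda>e. w e - \<mu>) (\<lambda>k. m k) \<le> c / 4 * l * n" if m: "m \<in> int_vectors n" for m :: "nat \<Rightarrow> int"
  proof -
    define P where "P e = (\<Prod>k\<in>e. real_of_int (m k))" for e
    define Hv where "Hv = {e \<in> pairs n. \<bar>P e\<bar> > \<tau> * l}"
    have "real_of_int (\<Sum>k<n. (m k)\<^sup>2) \<le> real_of_int (4 * int n)"
      using m unfolding int_vectors_def of_int_le_iff by simp
    then have m2: "(\<Sum>k<n. (real_of_int (m k))\<^sup>2) \<le> 4 * real n" by simp
    have "pairs n = light_pairs n (\<tau> * l) m \<union> Hv" "light_pairs n (\<tau> * l) m \<inter> Hv = {}"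
      by (auto simp: light_pairs_def Hv_def P_def)
    then have "pair_form n (\<lambda>e. w e - \<mu>) (\<lambda>k. m k) =
        (\<Sum>e\<in>light_pairs n (\<tau> * l) m. (w e - \<mu>) * P e) + (\<Sum>e\<in>Hv. (w e - \<mu>) * P e)"
      unfolding pair_form_def P_def
      by (metis (no_types, lifting) finite_Un finite_pairs sum.union_disjoint)
    also have "(\<Sum>e\<in>light_pairs n (\<tau> * l) m. (w e - \<mu>) * P e) \<le> c / 16 * l * n"
      using light[OF m] by (simp add: P_def)
    also have "(\<Sum>e\<in>Hv. (w e - \<mu>) * P e) \<le> (\<Sum>e\<in>Hv. \<bar>w e\<bar> * \<bar>P e\<bar> + \<mu> * \<bar>P e\<bar>)"
    proof (rule sum_mono)
      fix e
      have "(w e - \<mu>) * P e \<le> \<bar>w e - \<mu>\<bar> * \<bar>P e\<bar>" by (metis abs_ge_self abs_mult)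
      also have "\<dots> \<le> (\<bar>w e\<bar> + \<mu>) * \<bar>P e\<bar>" using \<mu> by (intro mult_right_mono) auto
      finally show "(w e - \<mu>) * P e \<le> \<bar>w e\<bar> * \<bar>P e\<bar> + \<mu> * \<bar>P e\<bar>" by (simp add: distrib_right)
    qed
    also have "\<dots> = (\<Sum>e\<in>Hv. \<bar>w e\<bar> * \<bar>P e\<bar>) + \<mu> * (\<Sum>e\<in>Hv. \<bar>P e\<bar>)"
      by (simp add: sum.distrib sum_distrib_left)
    also have "(\<Sum>e\<in>Hv. \<bar>w e\<bar> * \<bar>P e\<bar>) \<le> (\<gamma> * (K * l) + \<theta> * l / \<gamma>) * (4 * real n)"
      unfolding Hv_def P_def
      using deg sparse pos h l m2
      by (intro heavy_pairs_bound[where a = "\<lambda>e. \<bar>w e\<bar>" and D = "K * l" and Q = "4 * real n"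
        and \<gamma> = \<gamma> and h = "\<tau> * l" and \<rho> = "\<theta> * l" and m = m]) auto
    also have "\<dots> = (\<gamma> * K + \<theta> / \<gamma>) * (4 * real n * l)" by (simp add: algebra_simps)
    also have "\<dots> \<le> (c / 64 + c / 64) * (4 * real n * l)"
      using \<gamma> \<theta> l by (intro mult_right_mono add_mono) auto
    also have "\<dots> = c / 8 * l * n" by simp
    \<comment> \<open>On heavy pairs \<open>|P e| \<le> (P e)\<^sup>2 / (\<tau> l)\<close>.\<close>
    also have "\<mu> * (\<Sum>e\<in>Hv. \<bar>P e\<bar>) \<le> c / 16 * l * n"
    proof -
      have "(\<tau> * l) * (\<Sum>e\<in>Hv. \<bar>P e\<bar>) = (\<Sum>e\<in>Hv. (\<tau> * l) * \<bar>P e\<bar>)" by (simp add: sum_distrib_left)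
      also have "\<dots> \<le> (\<Sum>e\<in>Hv. \<bar>P e\<bar> * \<bar>P e\<bar>)" by (intro sum_mono mult_right_mono) (auto simp: Hv_def)
      also have "\<dots> \<le> (\<Sum>e\<in>pairs n. (P e)\<^sup>2)"
        by (simp add: power2_eq_square) (intro sum_mono2, auto simp: Hv_def)
      also have "\<dots> \<le> (4 * real n)\<^sup>2 / 2"
      proof -
        have "2 * (\<Sum>e\<in>pairs n. (P e)\<^sup>2) \<le> (\<Sum>k<n. (real_of_int (m k))\<^sup>2)\<^sup>2"
          unfolding P_def by (rule sum_squared_pair_products)
        also have "\<dots> \<le> (4 * real n)\<^sup>2" using m2 by (intro power_mono sum_nonneg) auto
        finally show ?thesis by simp
      qed
      finally have "(\<tau> * l) * (\<Sum>e\<in>Hv. \<bar>P e\<bar>) \<le> 8 * n * n" by (simp add: power2_eq_square)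
      then have "\<mu> * ((\<tau> * l) * (\<Sum>e\<in>Hv. \<bar>P e\<bar>)) \<le> \<mu> * (8 * n * n)" using \<mu> by (intro mult_left_mono) auto
      also have "\<dots> \<le> (a * l) * (8 * n)" using mult_right_mono[OF \<mu>(2), of "8 * n"] by (simp add: algebra_simps)
      also have "\<dots> = (8 * a) * (l * n)" by simp
      also have "\<dots> \<le> (c / 16 * \<tau> * l) * (l * n)" using al l by (intro mult_right_mono) auto
      finally have "(\<tau> * l) * (\<mu> * (\<Sum>e\<in>Hv. \<bar>P e\<bar>)) \<le> (\<tau> * l) * (c / 16 * l * n)"
        by (simp add: algebra_simps)
      then show ?thesis unfolding mult_le_cancel_left_pos[OF h] .
    qed
    finally show ?thesis by (simp add: algebra_simps)
  qed
  have "c / 2 * l * (\<Sum>i<n. (f i)\<^sup>2) \<le> dirichlet n w f" if f0: "(\<Sum>i<n. f i) = 0" for f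
  proof -
    have "0 = (\<Sum>i<n. (f i)\<^sup>2) + 2 * (\<Sum>e\<in>pairs n. \<Prod>k\<in>e. f k)"
      using square_sum_pairs[of f n] f0 by simp
    moreover have "0 \<le> (\<Sum>i<n. (f i)\<^sup>2)" by (intro sum_nonneg) auto
    ultimately have "\<mu> * (\<Sum>e\<in>pairs n. \<Prod>k\<in>e. f k) \<le> 0"
      using \<mu> by (intro mult_nonneg_nonpos) auto
    moreover have "(\<Sum>e\<in>pairs n. w e * (\<Prod>k\<in>e. f k)) =
        pair_form n (\<lambda>e. w e - \<mu>) f + \<mu> * (\<Sum>e\<in>pairs n. \<Prod>k\<in>e. f k)"
      by (simp add: pair_form_def left_diff_distrib sum_subtractf sum_distrib_left)
    ultimately have "(\<Sum>e\<in>pairs n. w e * (\<Prod>k\<in>e. f k)) \<le> c / 4 * l * (\<Sum>i<n. (f i)\<^sup>2)"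
      using pair_form_bound_of_int_vectors[OF form n, of f] by linarith
    moreover have "c * l * (\<Sum>i<n. (f i)\<^sup>2) \<le> (\<Sum>e\<in>pairs n. w e * (\<Sum>k\<in>e. (f k)\<^sup>2))"
    proof -
      have "c * l * (\<Sum>i<n. (f i)\<^sup>2) = (\<Sum>v<n. (f v)\<^sup>2 * (c * l))"
        by (simp add: sum_distrib_left mult.commute)
      also have "\<dots> \<le> (\<Sum>v<n. (f v)\<^sup>2 * vertex_weight n w v)"
        by (intro sum_mono mult_left_mono signed) auto
      finally show ?thesis by (simp add: sum_incidences)
    qed
    ultimately show ?thesis by (simp add: dirichlet_pairs algebra_simps)
  qed
  moreover have "dirichlet n w f \<le> 2 * (K * l) * (\<Sum>i<n. (f i)\<^sup>2)" for f
    by (rule dirichlet_le_degree) (rule deg)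
  ultimately show ?thesis by (simp add: spectral_window_def mult.assoc)
qed

section \<open>The random signed graph\<close>
text \<open>
  The law of one entry of the cost matrix after the signs \<open>z\<^sub>i z\<^sub>j\<close> are removed.
\<close>
definition signed_edge :: "real \<Rightarrow> real \<Rightarrow> real pmf" where
  "signed_edge p \<delta> = bind_pmf (bernoulli_pmf p)
     (\<lambda>present. if present then map_pmf (\<lambda>correct. if correct then 1 else - 1) (bernoulli_pmf ((1 + \<delta>) / 2))
        else return_pmf 0)"

definition signed_graph :: "nat \<Rightarrow> real \<Rightarrow> real \<Rightarrow> (nat set \<Rightarrow> real) pmf" where
  "signed_graph n p \<delta> = Pi_pmf (pairs n) 0 (\<lambda>_. signed_edge p \<delta>)"

definition gauged_weights :: "real vec \<Rightarrow> nat set set \<Rightarrow> (nat set \<Rightarrow> real) \<Rightarrow> nat set \<Rightarrow> real" where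
  "gauged_weights z E R e = (if e \<in> E then (\<Prod>k\<in>e. z $ k) * R e else 0)"

lemma prod_sign_vec_sq:
  assumes "z \<in> sign_vecs n" "e \<in> pairs n"
  shows "(\<Prod>k\<in>e. z $ k) * (\<Prod>k\<in>e. z $ k) = 1"
proof -
  have "(\<Prod>k\<in>e. z $ k) * (\<Prod>k\<in>e. z $ k) = (\<Prod>k\<in>e. z $ k * z $ k)" by (simp add: prod.distrib)
  also have "\<dots> = 1"
    using assms by (intro prod.neutral) (auto simp: sign_vecs_def nsets_def)
  finally show ?thesis .
qed

lemma map_gauged_measurements:
  assumes z: "z \<in> sign_vecs n" and E: "E \<subseteq> pairs n"
  shows "map_pmf (gauged_weights z E) (measurements z \<delta> E) =
    Pi_pmf E 0 (\<lambda>_. map_pmf (\<lambda>correct. if correct then 1 else - 1) (bernoulli_pmf ((1 + \<delta>) / 2)))"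
proof -
  have fin: "finite E" by (rule finite_subset[OF E finite_pairs])
  let ?s = "\<lambda>e. \<Prod>k\<in>e. z $ k"
  let ?p = "\<lambda>e. map_pmf (\<lambda>correct. if correct then ?s e else - ?s e) (bernoulli_pmf ((1 + \<delta>) / 2))"
  have "map_pmf (gauged_weights z E) (measurements z \<delta> E) =
      bind_pmf (Pi_pmf E 0 ?p) (\<lambda>R. return_pmf (gauged_weights z E R))"
    unfolding measurements_def by (rule map_pmf_def)
  also have "\<dots> = bind_pmf (Pi_pmf E 0 ?p) (\<lambda>R. Pi_pmf E 0 (\<lambda>e. return_pmf (?s e * R e)))"
    unfolding Pi_pmf_return_pmf[OF fin]
    by (simp only: gauged_weights_def[abs_def])
  also have "\<dots> = Pi_pmf E 0 (\<lambda>e. bind_pmf (?p e) (\<lambda>x. return_pmf (?s e * x)))"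
    by (rule Pi_pmf_bind[OF fin, symmetric])
  also have "\<dots> = Pi_pmf E 0 (\<lambda>_. map_pmf (\<lambda>correct. if correct then 1 else - 1) (bernoulli_pmf ((1 + \<delta>) / 2)))"
  proof (rule Pi_pmf_cong[OF refl refl])
    fix e assume e: "e \<in> E"
    have s: "?s e * ?s e = 1" by (rule prod_sign_vec_sq[OF z subsetD[OF E e]])
    have "bind_pmf (?p e) (\<lambda>x. return_pmf (?s e * x)) = map_pmf (\<lambda>x. ?s e * x) (?p e)"
      by (rule map_pmf_def[symmetric])
    also have "\<dots> = map_pmf (\<lambda>correct. if correct then 1 else - 1) (bernoulli_pmf ((1 + \<delta>) / 2))"
      unfolding map_pmf_comp by (intro map_pmf_cong refl) (simp add: s)
    finally show "bind_pmf (?p e) (\<lambda>x. return_pmf (?s e * x)) = \<dots>" .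
  qed
  finally show ?thesis .
qed

text \<open>
  Multiplication by \<open>z\<^sub>i z\<^sub>j\<close> undoes the sign of each measurement, and drawing a random edge set and then
  independent measurements on it is the same as drawing all pairs independently.
\<close>
lemma map_gauged_synchronization_model:
  assumes z: "z \<in> sign_vecs n"
  shows "map_pmf (\<lambda>(E, R). gauged_weights z E R) (synchronization_model n p z \<delta>) = signed_graph n p \<delta>"
proof -
  let ?M = "map_pmf (\<lambda>correct. if correct then 1 else - 1 :: real) (bernoulli_pmf ((1 + \<delta>) / 2))"
  let ?B = "Pi_pmf (pairs n) False (\<lambda>_. bernoulli_pmf p)"
  have "map_pmf (\<lambda>(E, R). gauged_weights z E R) (synchronization_model n p z \<delta>) =
      bind_pmf ?B (\<lambda>f. map_pmf (gauged_weights z {e \<in> pairs n. f e}) (measurements z \<delta> {e \<in> pairs n. f e}))"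
    by (simp add: synchronization_model_def erdos_renyi_def map_bind_pmf bind_map_pmf map_pmf_comp)
  also have "\<dots> = bind_pmf ?B (\<lambda>f. Pi_pmf {e \<in> pairs n. f e} 0 (\<lambda>_. ?M))"
    by (intro bind_pmf_cong refl map_gauged_measurements[OF z]) auto
  also have "\<dots> = bind_pmf ?B (\<lambda>f. Pi_pmf (pairs n) 0 (\<lambda>e. if f e then ?M else return_pmf 0))"
    by (simp add: Pi_pmf_if_set)
  also have "\<dots> = signed_graph n p \<delta>"
    unfolding signed_graph_def signed_edge_def by (rule Pi_pmf_bind[symmetric]) simp
  finally show ?thesis .
qed

lemma finite_set_signed_edge: "finite (set_pmf (signed_edge p \<delta>))"
  by (auto simp: signed_edge_def)

lemma expectation_signed_edge:
  fixes g :: "real \<Rightarrow> real"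
  assumes "0 \<le> p" "p \<le> 1" "0 \<le> \<delta>" "\<delta> \<le> 1"
  shows "measure_pmf.expectation (signed_edge p \<delta>) g =
    (1 - p) * g 0 + p * ((1 + \<delta>) / 2 * g 1 + (1 - \<delta>) / 2 * g (- 1))"
proof -
  have "measure_pmf.expectation (signed_edge p \<delta>) g = (\<Sum>b\<in>UNIV. pmf (bernoulli_pmf p) b *\<^sub>R
      measure_pmf.expectation (if b then map_pmf (\<lambda>correct. if correct then 1 else - 1) (bernoulli_pmf ((1 + \<delta>) / 2))
        else return_pmf 0) g)"
    unfolding signed_edge_def by (rule pmf_expectation_bind) auto
  also have "\<dots> = (1 - p) * g 0 + p * ((1 + \<delta>) / 2 * g 1 + (1 - \<delta>) / 2 * g (- 1))"
    using assms by (simp add: UNIV_bool field_simps)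
  finally show ?thesis .
qed

text \<open>
  Markov's inequality for the exponential of the sum, which factorizes by independence. All tail
  bounds below are instances, for different \<open>h\<close>.
\<close>
lemma chernoff_Pi_pmf:
  fixes h :: "'a \<Rightarrow> 'b \<Rightarrow> real"
  assumes A: "finite A" and fin: "\<And>x. x \<in> A \<Longrightarrow> finite (set_pmf (q x))"
    and mgf: "\<And>x. x \<in> A \<Longrightarrow> measure_pmf.expectation (q x) (\<lambda>y. exp (h x y)) \<le> exp (b x)"
  shows "measure_pmf.prob (Pi_pmf A d q) {w. t \<le> (\<Sum>x\<in>A. h x (w x))} \<le> exp ((\<Sum>x\<in>A. b x) - t)"
proof -
  let ?M = "measure_pmf (Pi_pmf A d q)"
  let ?u = "\<lambda>w. \<Prod>x\<in>A. exp (h x (w x))"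
  have int: "integrable (measure_pmf (q x)) (\<lambda>y. exp (h x y))" if "x \<in> A" for x
    by (intro integrable_measure_pmf_finite fin that)
  have "{w. t \<le> (\<Sum>x\<in>A. h x (w x))} = {w \<in> space ?M. exp t \<le> ?u w}"
    using A by (simp flip: exp_sum)
  then have "measure ?M {w. t \<le> (\<Sum>x\<in>A. h x (w x))} \<le> integral\<^sup>L ?M ?u / exp t"
    using integral_Markov_inequality_measure[of ?M ?u "{}" "exp t"]
      integrable_prod_Pi_pmf[OF A int] by (simp add: prod_nonneg)
  also have "integral\<^sup>L ?M ?u = (\<Prod>x\<in>A. measure_pmf.expectation (q x) (\<lambda>y. exp (h x y)))"
    by (rule expectation_prod_Pi_pmf[OF A int]) auto
  also have "\<dots> \<le> (\<Prod>x\<in>A. exp (b x))"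
    by (intro prod_mono conjI mgf Bochner_Integration.integral_nonneg) auto
  also have "\<dots> / exp t = exp ((\<Sum>x\<in>A. b x) - t)"
    using A by (simp add: exp_sum exp_diff)
  finally show ?thesis by (simp add: divide_right_mono)
qed

lemma prob_union_bound:
  fixes P :: "'i \<Rightarrow> 'b \<Rightarrow> bool"
  assumes "finite I" "\<And>i. i \<in> I \<Longrightarrow> measure_pmf.prob M {w. P i w} \<le> f i"
  shows "measure_pmf.prob M {w. \<exists>i\<in>I. P i w} \<le> (\<Sum>i\<in>I. f i)"
proof -
  have "measure_pmf.prob M {w. \<exists>i\<in>I. P i w} = measure_pmf.prob M (\<Union>i\<in>I. {w. P i w})"
    by (rule arg_cong[where f = "measure_pmf.prob M"]) auto
  also have "\<dots> \<le> (\<Sum>i\<in>I. measure_pmf.prob M {w. P i w})"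
    using assms by (intro measure_pmf.finite_measure_subadditive_finite) auto
  also have "\<dots> \<le> (\<Sum>i\<in>I. f i)" by (intro sum_mono assms)
  finally show ?thesis .
qed

lemma exp_le_quadratic:
  fixes y :: real
  assumes "\<bar>y\<bar> \<le> 1"
  shows "exp y \<le> 1 + y + y\<^sup>2"
proof (cases "y \<ge> 0")
  case True
  then show ?thesis using assms exp_bound by auto
next
  case False
  define x where "x = - y"
  have x: "0 < x" "x \<le> 1" using False assms by (auto simp: x_def)
  have L: "1 + x + x\<^sup>2 / 2 \<le> exp x" using x by (intro exp_lower_Taylor_quadratic) auto
  have pos: "0 \<le> 1 - x + x\<^sup>2" using x by simp
  have "(1 - x + x\<^sup>2) * (1 + x + x\<^sup>2 / 2) = 1 + x\<^sup>2 / 2 + x ^ 3 / 2 + x ^ 4 / 2"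
    by (simp add: field_simps power2_eq_square power3_eq_cube power4_eq_xxxx)
  then have "1 \<le> (1 - x + x\<^sup>2) * (1 + x + x\<^sup>2 / 2)" using x by simp
  also have "\<dots> \<le> (1 - x + x\<^sup>2) * exp x" using L pos by (intro mult_left_mono)
  finally have "exp (- x) \<le> 1 - x + x\<^sup>2" by (simp add: exp_minus field_simps)
  then show ?thesis by (simp add: x_def)
qed

lemma card_incident_pairs:
  assumes "v < n"
  shows "card {e \<in> pairs n. v \<in> e} = n - 1"
proof -
  have "{e \<in> pairs n. v \<in> e} = (\<lambda>u. {u, v}) ` ({..<n} - {v})"
    using assms by (auto simp: nsets_2_eq image_iff insert_commute)
  moreover have "inj_on (\<lambda>u. {u, v}) ({..<n} - {v})" by (auto simp: inj_on_def doubleton_eq_iff)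
  ultimately show ?thesis using assms by (simp add: card_image)
qed

context
  fixes p \<delta> :: real
  assumes p: "0 \<le> p" "p \<le> 1" and \<delta>: "0 \<le> \<delta>" "\<delta> \<le> 1"
begin

lemma chernoff_signed_graph:
  assumes A: "A \<subseteq> pairs n"
    and mgf: "\<And>e. e \<in> A \<Longrightarrow> (1 - p) * exp (h e 0) + p * ((1 + \<delta>) / 2 * exp (h e 1) + (1 - \<delta>) / 2 * exp (h e (- 1))) \<le> exp (b e)"
  shows "measure_pmf.prob (signed_graph n p \<delta>) {w. t \<le> (\<Sum>e\<in>A. h e (w e))} \<le> exp ((\<Sum>e\<in>A. b e) - t)"
proof -
  have sum_if: "(\<Sum>e\<in>pairs n. if e \<in> A then f e else 0) = sum f A" for f :: "nat set \<Rightarrow> real"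
    using A by (simp add: sum.inter_restrict[symmetric] Int_absorb1)
  have one: "(1 + \<delta>) / 2 + (1 - \<delta>) / 2 = 1" by (simp add: field_simps)
  have "measure_pmf.prob (signed_graph n p \<delta>) {w. t \<le> (\<Sum>e\<in>pairs n. if e \<in> A then h e (w e) else 0)}
      \<le> exp ((\<Sum>e\<in>pairs n. if e \<in> A then b e else 0) - t)"
    unfolding signed_graph_def
    by (rule chernoff_Pi_pmf[where h = "\<lambda>e x. if e \<in> A then h e x else 0"])
      (use mgf in \<open>auto simp: finite_set_signed_edge expectation_signed_edge p \<delta> one\<close>)
  then show ?thesis by (simp add: sum_if)
qed

lemma prob_large_degree:
  assumes v: "v < n"
  shows "measure_pmf.prob (signed_graph n p \<delta>) {w. \<not> vertex_weight n (\<lambda>e. \<bar>w e\<bar>) v \<le> D} \<le> exp (2 * p * n - D)"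
proof -
  have "(1 - p) + p * exp 1 \<le> exp (2 * p)"
  proof -
    have "(1 - p) + p * exp 1 \<le> (1 - p) + p * 3" using p exp_le by (intro add_mono mult_left_mono) auto
    also have "\<dots> = 1 + 2 * p" by simp
    also have "\<dots> \<le> exp (2 * p)" by (rule exp_ge_add_one_self)
    finally show ?thesis .
  qed
  then have mgf: "(1 - p) * exp \<bar>0\<bar> + p * ((1 + \<delta>) / 2 * exp \<bar>1\<bar> + (1 - \<delta>) / 2 * exp \<bar>- 1\<bar>) \<le> exp (2 * p)"
    by (simp add: field_simps)
  have "measure_pmf.prob (signed_graph n p \<delta>) {w. \<not> vertex_weight n (\<lambda>e. \<bar>w e\<bar>) v \<le> D}
      \<le> measure_pmf.prob (signed_graph n p \<delta>) {w. D \<le> (\<Sum>e\<in>{e \<in> pairs n. v \<in> e}. \<bar>w e\<bar>)}"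
    by (intro measure_pmf.finite_measure_mono) (auto simp: vertex_weight_def)
  also have "\<dots> \<le> exp ((\<Sum>e\<in>{e \<in> pairs n. v \<in> e}. 2 * p) - D)"
    by (rule chernoff_signed_graph) (use mgf in auto)
  also have "\<dots> \<le> exp (2 * p * n - D)"
    using p v by (simp add: card_incident_pairs mult.commute mult_left_mono)
  finally show ?thesis .
qed

text \<open>
  With \<open>t = exp (- \<lambda>)\<close>, the expression \<open>(1 + \<delta>) / 2 * t + (1 - \<delta>) / (2 * t)\<close> is the moment generating
  function at \<open>- \<lambda>\<close> of the sign of a present edge.
\<close>
lemma prob_small_signed_degree:
  assumes v: "v < n" and t: "0 < t" "t \<le> 1"
  shows "measure_pmf.prob (signed_graph n p \<delta>) {w. \<not> D \<le> vertex_weight n w v}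
    \<le> exp (- (p * (real n - 1) * (1 - ((1 + \<delta>) / 2 * t + (1 - \<delta>) / (2 * t)))) - D * ln t)"
proof -
  define f where "f = (1 + \<delta>) / 2 * t + (1 - \<delta>) / (2 * t)"
  have et: "exp (ln t) = t" "exp (- ln t) = 1 / t" using t by (simp_all add: exp_minus field_simps)
  have "(1 - p) * exp (0 * ln t) + p * ((1 + \<delta>) / 2 * exp (1 * ln t) + (1 - \<delta>) / 2 * exp (- 1 * ln t))
      = 1 + (- p * (1 - f))"
    using t by (simp add: et f_def field_simps)
  also have "\<dots> \<le> exp (- p * (1 - f))" by (rule exp_ge_add_one_self)
  finally have mgf: "(1 - p) * exp (0 * ln t) + p * ((1 + \<delta>) / 2 * exp (1 * ln t) + (1 - \<delta>) / 2 * exp (- 1 * ln t))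
      \<le> exp (- p * (1 - f))" .
  have lnt: "ln t \<le> 0" using t by simp
  have "measure_pmf.prob (signed_graph n p \<delta>) {w. \<not> D \<le> vertex_weight n w v}
      \<le> measure_pmf.prob (signed_graph n p \<delta>) {w. D * ln t \<le> (\<Sum>e\<in>{e \<in> pairs n. v \<in> e}. w e * ln t)}"
    using lnt by (intro measure_pmf.finite_measure_mono)
      (auto simp: vertex_weight_def not_le intro!: mult_right_mono_neg simp flip: sum_distrib_right)
  also have "\<dots> \<le> exp ((\<Sum>e\<in>{e \<in> pairs n. v \<in> e}. - p * (1 - f)) - D * ln t)"
    by (rule chernoff_signed_graph) (use mgf in auto)
  also have "(\<Sum>e\<in>{e \<in> pairs n. v \<in> e}. - p * (1 - f)) = - (p * (real n - 1) * (1 - f))"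
    using v by (simp add: card_incident_pairs of_nat_diff algebra_simps)
  finally show ?thesis by (simp add: f_def)
qed

lemma mgf_centred_signed_edge:
  assumes s: "\<bar>s\<bar> \<le> 1 / 2"
  shows "(1 - p) * exp (s * (0 - p * \<delta>)) + p * ((1 + \<delta>) / 2 * exp (s * (1 - p * \<delta>))
    + (1 - \<delta>) / 2 * exp (s * (- 1 - p * \<delta>))) \<le> exp (p * s\<^sup>2)"
proof -
  have \<mu>: "0 \<le> p * \<delta>" "p * \<delta> \<le> 1" using p \<delta> by (auto simp: mult_le_one)
  have q: "exp (s * (x - p * \<delta>)) \<le> 1 + s * (x - p * \<delta>) + (s * (x - p * \<delta>))\<^sup>2" if "\<bar>x\<bar> \<le> 1" for x
  proof (rule exp_le_quadratic)
    have "\<bar>s * (x - p * \<delta>)\<bar> \<le> 1 / 2 * 2"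
      unfolding abs_mult using s that \<mu> by (intro mult_mono) auto
    then show "\<bar>s * (x - p * \<delta>)\<bar> \<le> 1" by simp
  qed
  have "(1 - p) * exp (s * (0 - p * \<delta>)) + p * ((1 + \<delta>) / 2 * exp (s * (1 - p * \<delta>))
      + (1 - \<delta>) / 2 * exp (s * (- 1 - p * \<delta>)))
    \<le> (1 - p) * (1 + s * (0 - p * \<delta>) + (s * (0 - p * \<delta>))\<^sup>2)
      + p * ((1 + \<delta>) / 2 * (1 + s * (1 - p * \<delta>) + (s * (1 - p * \<delta>))\<^sup>2)
      + (1 - \<delta>) / 2 * (1 + s * (- 1 - p * \<delta>) + (s * (- 1 - p * \<delta>))\<^sup>2))"
    using p \<delta> by (intro add_mono mult_left_mono q) auto
  also have "\<dots> = 1 + p * s\<^sup>2 - (s * (p * \<delta>))\<^sup>2"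
    by (simp add: power2_eq_square field_simps)
  also have "\<dots> \<le> 1 + p * s\<^sup>2" by simp
  also have "\<dots> \<le> exp (p * s\<^sup>2)" by (rule exp_ge_add_one_self)
  finally show ?thesis .
qed

text \<open>
  The Chernoff parameter \<open>1 / (2 h)\<close> keeps every exponent of a light pair in the range where the
  exponential is bounded by a quadratic. For \<open>h\<close> of order \<open>ln n\<close> the variance term is of lower order.
\<close>
lemma prob_large_light_sum:
  assumes h: "h > 0" and m: "m \<in> int_vectors n"
  shows "measure_pmf.prob (signed_graph n p \<delta>)
      {w. \<not> (\<Sum>e\<in>light_pairs n h m. (w e - p * \<delta>) * (\<Prod>k\<in>e. real_of_int (m k))) \<le> b}
    \<le> exp (2 * p * (real n)\<^sup>2 / h\<^sup>2 - b / (2 * h))"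
proof -
  define P where "P e = (\<Prod>k\<in>e. real_of_int (m k))" for e
  define L where "L = light_pairs n h m"
  have L: "L \<subseteq> pairs n" "\<And>e. e \<in> L \<Longrightarrow> \<bar>P e\<bar> \<le> h" by (auto simp: L_def light_pairs_def P_def)
  have "real_of_int (\<Sum>k<n. (m k)\<^sup>2) \<le> real_of_int (4 * int n)"
    using m unfolding int_vectors_def of_int_le_iff by simp
  then have m2: "(\<Sum>k<n. (real_of_int (m k))\<^sup>2) \<le> 4 * n" by simp
  have "2 * (\<Sum>e\<in>pairs n. (P e)\<^sup>2) \<le> (\<Sum>k<n. (real_of_int (m k))\<^sup>2)\<^sup>2"
    unfolding P_def by (rule sum_squared_pair_products)
  also have "\<dots> \<le> (4 * real n)\<^sup>2" using m2 by (intro power_mono sum_nonneg) auto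
  finally have "(\<Sum>e\<in>pairs n. (P e)\<^sup>2) \<le> 8 * (real n)\<^sup>2" by simp
  moreover have "(\<Sum>e\<in>L. (P e)\<^sup>2) \<le> (\<Sum>e\<in>pairs n. (P e)\<^sup>2)" using L by (intro sum_mono2) auto
  ultimately have P2: "(\<Sum>e\<in>L. (P e)\<^sup>2) \<le> 8 * (real n)\<^sup>2" by linarith
  have "measure_pmf.prob (signed_graph n p \<delta>) {w. \<not> (\<Sum>e\<in>L. (w e - p * \<delta>) * P e) \<le> b}
    \<le> measure_pmf.prob (signed_graph n p \<delta>) {w. b / (2 * h) \<le> (\<Sum>e\<in>L. P e / (2 * h) * (w e - p * \<delta>))}"
  proof (intro measure_pmf.finite_measure_mono subsetI CollectI)
    fix w assume "w \<in> {w. \<not> (\<Sum>e\<in>L. (w e - p * \<delta>) * P e) \<le> b}"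
    then have "b / (2 * h) \<le> (\<Sum>e\<in>L. (w e - p * \<delta>) * P e) / (2 * h)"
      using h by (intro divide_right_mono) auto
    also have "\<dots> = (\<Sum>e\<in>L. P e / (2 * h) * (w e - p * \<delta>))"
      unfolding sum_divide_distrib by (intro sum.cong refl) simp
    finally show "b / (2 * h) \<le> (\<Sum>e\<in>L. P e / (2 * h) * (w e - p * \<delta>))" .
  qed auto
  also have "\<dots> \<le> exp ((\<Sum>e\<in>L. p * (P e / (2 * h))\<^sup>2) - b / (2 * h))"
  proof (rule chernoff_signed_graph[OF L(1)])
    fix e assume "e \<in> L"
    then have "\<bar>P e / (2 * h)\<bar> \<le> 1 / 2" using L(2)[of e] h by (simp add: field_simps abs_mult)
    from mgf_centred_signed_edge[OF this]
    show "(1 - p) * exp (P e / (2 * h) * (0 - p * \<delta>)) + p * ((1 + \<delta>) / 2 * exp (P e / (2 * h) * (1 - p * \<delta>))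
      + (1 - \<delta>) / 2 * exp (P e / (2 * h) * (- 1 - p * \<delta>))) \<le> exp (p * (P e / (2 * h))\<^sup>2)" .
  qed
  also have "\<dots> \<le> exp (2 * p * (real n)\<^sup>2 / h\<^sup>2 - b / (2 * h))"
  proof -
    have "(\<Sum>e\<in>L. p * (P e / (2 * h))\<^sup>2) = p / (4 * h\<^sup>2) * (\<Sum>e\<in>L. (P e)\<^sup>2)"
      unfolding sum_distrib_left by (intro sum.cong refl) (simp add: power_divide power_mult_distrib)
    also have "\<dots> \<le> p / (4 * h\<^sup>2) * (8 * (real n)\<^sup>2)"
      using P2 p by (intro mult_left_mono) auto
    also have "\<dots> = 2 * p * (real n)\<^sup>2 / h\<^sup>2" by simp
    finally show ?thesis by simp
  qed
  finally show ?thesis by (simp add: L_def P_def)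
qed

lemma prob_dense_subset:
  assumes T: "T \<subseteq> {..<n}" and \<Lambda>: "\<Lambda> > 0"
  shows "measure_pmf.prob (signed_graph n p \<delta>) {w. \<not> (\<Sum>e\<in>{e \<in> pairs n. e \<subseteq> T}. \<bar>w e\<bar>) \<le> D}
    \<le> exp (p * exp \<Lambda> * (real (card T))\<^sup>2 - \<Lambda> * D)"
proof -
  have fT: "finite T" by (rule finite_subset[OF T]) simp
  have "{e \<in> pairs n. e \<subseteq> T} \<subseteq> [T]\<^bsup>2\<^esup>" by (auto simp: nsets_def)
  then have "card {e \<in> pairs n. e \<subseteq> T} \<le> card ([T]\<^bsup>2\<^esup>)"
    using fT by (intro card_mono finite_imp_finite_nsets)
  also have "\<dots> \<le> card T * (card T - 1)" by (simp add: card_nsets choose_two)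
  also have "\<dots> \<le> (card T)\<^sup>2" by (simp add: power2_eq_square)
  finally have cT: "real (card {e \<in> pairs n. e \<subseteq> T}) \<le> (real (card T))\<^sup>2"
    by (metis of_nat_le_iff of_nat_power)
  have "1 + p * exp \<Lambda> \<le> exp (p * exp \<Lambda>)" by (rule exp_ge_add_one_self)
  then have "(1 - p) + p * exp \<Lambda> \<le> exp (p * exp \<Lambda>)" using p by linarith
  then have mgf: "(1 - p) * exp (\<Lambda> * \<bar>0\<bar>) + p * ((1 + \<delta>) / 2 * exp (\<Lambda> * \<bar>1\<bar>) + (1 - \<delta>) / 2 * exp (\<Lambda> * \<bar>- 1\<bar>))
      \<le> exp (p * exp \<Lambda>)"
    by (simp add: field_simps)
  have "measure_pmf.prob (signed_graph n p \<delta>) {w. \<not> (\<Sum>e\<in>{e \<in> pairs n. e \<subseteq> T}. \<bar>w e\<bar>) \<le> D}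
    \<le> measure_pmf.prob (signed_graph n p \<delta>) {w. \<Lambda> * D \<le> (\<Sum>e\<in>{e \<in> pairs n. e \<subseteq> T}. \<Lambda> * \<bar>w e\<bar>)}"
    using \<Lambda> by (intro measure_pmf.finite_measure_mono) (auto simp flip: sum_distrib_left)
  also have "\<dots> \<le> exp ((\<Sum>e\<in>{e \<in> pairs n. e \<subseteq> T}. p * exp \<Lambda>) - \<Lambda> * D)"
    by (rule chernoff_signed_graph) (use mgf in auto)
  also have "\<dots> \<le> exp (p * exp \<Lambda> * (real (card T))\<^sup>2 - \<Lambda> * D)"
    using mult_left_mono[OF cT, of "p * exp \<Lambda>"] p by (simp add: mult.commute mult.left_commute)
  finally show ?thesis .
qed

end

section \<open>The spectral window holds with high probability\<close>
text \<open>
  A vector in the set has Gaussian weight \<open>exp (- \<Sum> m\<^sub>k\<^sup>2) \<ge> exp (- 4 n)\<close>, while the total weight of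
  all integer vectors is a product of \<open>n\<close> one-dimensional sums, each at most \<open>3 \<le> exp 2\<close>.
\<close>
lemma finite_int_vectors: "finite (int_vectors n)"
  and card_int_vectors_le: "real (card (int_vectors n)) \<le> exp (6 * real n)"
proof -
  define N where "N = 4 * int n"
  define J where "J = {- N..N}"
  define g where "g k = exp (- (real_of_int k)\<^sup>2)" for k :: int
  have sub: "int_vectors n \<subseteq> Pi\<^sub>E {..<n} (\<lambda>_. J)"
  proof
    fix m assume m: "m \<in> int_vectors n"
    have "m k \<in> J" if "k < n" for k
    proof -
      have "\<bar>m k\<bar> \<le> \<bar>m k\<bar> * \<bar>m k\<bar>"
        using mult_left_mono[of 1 "\<bar>m k\<bar>" "\<bar>m k\<bar>"] by (cases "m k = 0") auto
      also have "\<dots> = (m k)\<^sup>2" by (simp add: power2_eq_square)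
      also have "\<dots> \<le> (\<Sum>k<n. (m k)\<^sup>2)" using that by (intro member_le_sum) auto
      also have "\<dots> \<le> N" using m by (simp add: int_vectors_def N_def)
      finally show ?thesis by (auto simp: J_def)
    qed
    then show "m \<in> Pi\<^sub>E {..<n} (\<lambda>_. J)" using m by (auto simp: int_vectors_def PiE_def)
  qed
  have finJ: "finite (Pi\<^sub>E {..<n} (\<lambda>_. J))" by (intro finite_PiE) (auto simp: J_def)
  show fin: "finite (int_vectors n)" by (rule finite_subset[OF sub finJ])
  have one_dim: "(\<Sum>k\<in>J. g k) \<le> 3"
  proof -
    have half: "(\<Sum>k=1..M. (1 / 2 :: real) ^ k) \<le> 1" for M :: nat
    proof -
      have "(\<Sum>k=1..M. (1 / 2 :: real) ^ k) = 1 - (1 / 2) ^ M" by (induction M) auto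
      then show ?thesis by simp
    qed
    have gk: "g (int k) \<le> (1 / 2) ^ k" if "k \<ge> 1" for k
    proof -
      have "real k \<le> (real k)\<^sup>2" using that by (simp add: power2_eq_square)
      then have "g (int k) \<le> exp (- real k)" by (simp add: g_def)
      also have "\<dots> = (exp (- 1)) ^ k" by (simp flip: exp_of_nat_mult)
      also have "\<dots> \<le> (1 / 2) ^ k"
        using exp_ge_add_one_self[of "1 :: real"] by (intro power_mono) (auto simp: exp_minus field_simps)
      finally show ?thesis .
    qed
    define M where "M = nat N"
    have posN: "int M = N" by (simp add: M_def N_def)
    have J: "J = {0} \<union> (int ` {1..M}) \<union> ((\<lambda>k. - int k) ` {1..M})"
    proof (intro equalityI subsetI)
      fix k assume "k \<in> J"
      then have k: "- int M \<le> k" "k \<le> int M" by (auto simp: J_def posN)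
      consider "k = 0" | "k > 0" | "k < 0" by linarith
      then show "k \<in> {0} \<union> (int ` {1..M}) \<union> ((\<lambda>k. - int k) ` {1..M})"
      proof cases
        case 2
        then have "k = int (nat k)" "nat k \<in> {1..M}" using k by auto
        then show ?thesis by blast
      next
        case 3
        then have "k = - int (nat (- k))" "nat (- k) \<in> {1..M}" using k by auto
        then show ?thesis by blast
      qed auto
    qed (auto simp: J_def simp flip: posN)
    have "(\<Sum>k\<in>J. g k) = (\<Sum>k\<in>{0} \<union> int ` {1..M}. g k) + (\<Sum>k\<in>(\<lambda>k. - int k) ` {1..M}. g k)"
      unfolding J by (rule sum.union_disjoint) auto
    also have "(\<Sum>k\<in>{0} \<union> int ` {1..M}. g k) = (\<Sum>k\<in>{0}. g k) + (\<Sum>k\<in>int ` {1..M}. g k)"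
      by (rule sum.union_disjoint) auto
    also have "(\<Sum>k\<in>{0}. g k) + (\<Sum>k\<in>int ` {1..M}. g k) + (\<Sum>k\<in>(\<lambda>k. - int k) ` {1..M}. g k)
        = 1 + (\<Sum>k=1..M. g (int k)) + (\<Sum>k=1..M. g (- int k))"
      by (simp add: sum.reindex inj_on_def g_def)
    also have "\<dots> = 1 + 2 * (\<Sum>k=1..M. g (int k))" by (simp add: g_def)
    also have "\<dots> \<le> 1 + 2 * (\<Sum>k=1..M. (1 / 2) ^ k)"
      by (intro add_left_mono mult_left_mono sum_mono gk) auto
    also have "\<dots> \<le> 3" using half[of M] by simp
    finally show ?thesis .
  qed
  have "real (card (int_vectors n)) * exp (- 4 * real n) = (\<Sum>m\<in>int_vectors n. exp (- 4 * real n))"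
    by simp
  also have "\<dots> \<le> (\<Sum>m\<in>int_vectors n. \<Prod>k<n. g (m k))"
  proof (rule sum_mono)
    fix m assume "m \<in> int_vectors n"
    then have "real_of_int (\<Sum>k<n. (m k)\<^sup>2) \<le> real_of_int (4 * int n)"
      unfolding int_vectors_def of_int_le_iff by simp
    then have "exp (- 4 * real n) \<le> exp (\<Sum>k<n. - (real_of_int (m k))\<^sup>2)" by (simp add: sum_negf)
    also have "\<dots> = (\<Prod>k<n. g (m k))" by (simp add: g_def exp_sum)
    finally show "exp (- 4 * real n) \<le> (\<Prod>k<n. g (m k))" .
  qed
  also have "\<dots> \<le> (\<Sum>m\<in>Pi\<^sub>E {..<n} (\<lambda>_. J). \<Prod>k<n. g (m k))"
    using finJ sub by (intro sum_mono2) (auto simp: g_def intro!: prod_nonneg)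
  also have "\<dots> = (\<Prod>k<n. \<Sum>j\<in>J. g j)"
    by (subst prod_sum_PiE) (auto simp: J_def)
  also have "\<dots> \<le> 3 ^ n"
    using one_dim by (simp add: power_mono sum_nonneg g_def)
  also have "\<dots> \<le> (exp 2) ^ n"
    using exp_ge_add_one_self[of "2 :: real"] by (intro power_mono) auto
  also have "\<dots> = exp (2 * real n)" by (simp add: exp_of_nat_mult mult.commute flip: exp_of_nat_mult)
  finally have "real (card (int_vectors n)) * exp (- 4 * real n) * exp (4 * real n) \<le> exp (2 * real n) * exp (4 * real n)"
    by (intro mult_right_mono) auto
  then show "real (card (int_vectors n)) \<le> exp (6 * real n)"
    by (simp add: mult.assoc flip: exp_add)
qed

lemma sum_powers_nonempty_subsets:
  fixes q :: real
  shows "(\<Sum>T\<in>Pow {..<n} - {{}}. q ^ card T) = (1 + q) ^ n - 1"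
proof -
  have "(1 + q) ^ n = (\<Prod>k<n. q + 1)" by (simp add: add.commute)
  also have "\<dots> = (\<Sum>T\<in>Pow {..<n}. q ^ card T)"
    by (subst prod_add) auto
  also have "\<dots> = (\<Sum>T\<in>Pow {..<n} - {{}}. q ^ card T) + 1"
    by (subst sum.remove[of _ "{}"]) auto
  finally show ?thesis by simp
qed

text \<open>
  For \<open>\<delta> < 1\<close> the minimum of \<open>(1 + \<delta>) / 2 * t + (1 - \<delta>) / (2 * t)\<close> is \<open>sqrt (1 - \<delta>\<^sup>2)\<close>, attained at
  \<open>t = sqrt (1 - \<delta>\<^sup>2) / (1 + \<delta>)\<close>. That point tends to \<open>0\<close> as \<open>\<delta>\<close> tends to \<open>1\<close>; shifting it by \<open>\<eta>\<close> keeps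
  \<open>ln t\<close> bounded uniformly in \<open>\<delta>\<close>, at the price of an error \<open>\<eta>\<close> in the value.
\<close>
lemma exponential_tilt:
  fixes \<delta> \<eta> :: real
  assumes \<delta>: "0 \<le> \<delta>" "\<delta> \<le> 1" and \<eta>: "\<eta> > 0"
  obtains t where "\<eta> \<le> t" "t \<le> sqrt (1 - \<delta>\<^sup>2) + \<eta>"
    "(1 + \<delta>) / 2 * t + (1 - \<delta>) / (2 * t) \<le> sqrt (1 - \<delta>\<^sup>2) + \<eta>"
proof
  define s where "s = sqrt (1 - \<delta>\<^sup>2)"
  have d2: "\<delta>\<^sup>2 \<le> 1" using \<delta> by (simp add: power_le_one)
  have s: "s \<ge> 0" "s * s = 1 - \<delta>\<^sup>2" using d2 by (auto simp: s_def)
  define t where "t = s / (1 + \<delta>) + \<eta>"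
  have pos: "0 < 1 + \<delta>" using \<delta> by simp
  show t1: "\<eta> \<le> t" using s pos by (simp add: t_def)
  have "s / (1 + \<delta>) \<le> s" using s \<delta> by (simp add: field_simps)
  then show "t \<le> sqrt (1 - \<delta>\<^sup>2) + \<eta>" by (simp add: t_def s_def)
  have "(1 + \<delta>) / 2 * t = s / 2 + (1 + \<delta>) / 2 * \<eta>" using pos by (simp add: t_def field_simps)
  also have "\<dots> \<le> s / 2 + 1 * \<eta>" using \<delta> \<eta> by (intro add_left_mono mult_right_mono) auto
  finally have a: "(1 + \<delta>) / 2 * t \<le> s / 2 + \<eta>" by simp
  have "1 - \<delta> = s * (s / (1 + \<delta>))" using pos s by (simp add: field_simps power2_eq_square)
  also have "\<dots> \<le> s * t" using s \<eta> by (intro mult_left_mono) (auto simp: t_def)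
  finally have "(1 - \<delta>) / (2 * t) \<le> s / 2" using t1 \<eta> by (simp add: field_simps)
  with a show "(1 + \<delta>) / 2 * t + (1 - \<delta>) / (2 * t) \<le> sqrt (1 - \<delta>\<^sup>2) + \<eta>"
    unfolding s_def by linarith
qed

text \<open>
  The multiple of \<open>ln n\<close> that all signed degrees reach with high probability. The tilt by
  \<open>t \<ge> \<epsilon> / (2 a)\<close> costs at most \<open>- ln t \<le> 2 a / \<epsilon>\<close> per unit of degree, so this margin spends a quarter of \<open>\<epsilon>\<close> in the exponent.
\<close>
definition degree_margin :: "real \<Rightarrow> real \<Rightarrow> real" where
  "degree_margin a \<epsilon> = \<epsilon>\<^sup>2 / (8 * a)"

text \<open>
  The threshold hypothesis enters here. The shift by \<open>\<eta> = \<epsilon> / (2 a)\<close> and the degree margin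
  use up three quarters of the excess \<open>\<epsilon>\<close>, and the last quarter survives a union bound over \<open>n\<close>
  vertices.
\<close>
lemma prob_signed_degree_below_margin:
  fixes a \<epsilon> \<delta> :: real
  assumes a: "a > 1" and \<epsilon>: "\<epsilon> > 0" and \<delta>: "0 \<le> \<delta>" "\<delta> \<le> 1"
    and gap: "a * (1 - sqrt (1 - \<delta>\<^sup>2)) \<ge> 1 + \<epsilon>"
    and p: "p = a * ln n / n" "p \<le> 1" and n: "n \<ge> 2" and v: "v < n"
  shows "measure_pmf.prob (signed_graph n p \<delta>) {w. \<not> degree_margin a \<epsilon> * ln n \<le> vertex_weight n w v}
    \<le> exp (1 - (1 + \<epsilon> / 4) * ln n)"
proof -
  define l where "l = ln (real n)"
  define \<eta> where "\<eta> = \<epsilon> / (2 * a)"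
  define c where "c = degree_margin a \<epsilon>"
  have l: "l > 0" using n by (simp add: l_def)
  have \<eta>: "\<eta> > 0" using a \<epsilon> by (simp add: \<eta>_def)
  have c: "c > 0" using a \<epsilon> by (simp add: c_def degree_margin_def)
  have a\<eta>: "a * \<eta> = \<epsilon> / 2" using a by (simp add: \<eta>_def)
  obtain t where t: "\<eta> \<le> t" "t \<le> sqrt (1 - \<delta>\<^sup>2) + \<eta>"
    "(1 + \<delta>) / 2 * t + (1 - \<delta>) / (2 * t) \<le> sqrt (1 - \<delta>\<^sup>2) + \<eta>"
    using exponential_tilt[OF \<delta> \<eta>] .
  define f where "f = (1 + \<delta>) / 2 * t + (1 - \<delta>) / (2 * t)"
  have t0: "t > 0" using t \<eta> by simp
  have "a * t \<le> a * (sqrt (1 - \<delta>\<^sup>2) + \<eta>)" using t a by (intro mult_left_mono) auto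
  also have "\<dots> \<le> a - 1 - \<epsilon> / 2" using gap a\<eta> by (simp add: algebra_simps)
  also have "\<dots> \<le> a * 1" using \<epsilon> by simp
  finally have t1: "t \<le> 1" using a by (subst (asm) mult_le_cancel_left_pos) auto
  have f0: "f \<ge> 0" using t0 \<delta> by (simp add: f_def)
  have p0: "p \<ge> 0" using a l p n by (simp add: l_def)
  have "a * f \<le> a * (sqrt (1 - \<delta>\<^sup>2) + \<eta>)" using t a by (intro mult_left_mono) (auto simp: f_def)
  then have af: "a * (1 - f) \<ge> 1 + \<epsilon> / 2" using gap a\<eta> by (simp add: algebra_simps)
  have "p * (real n - 1) * (1 - f) = l * (a * (1 - f)) - p * (1 - f)"
    using n by (simp add: p l_def field_simps)
  moreover have "l * (a * (1 - f)) \<ge> l * (1 + \<epsilon> / 2)" using af l by (intro mult_left_mono) auto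
  moreover have "p * (1 - f) \<le> 1" using p p0 f0 mult_left_le[of "1 - f" p] by linarith
  ultimately have main: "p * (real n - 1) * (1 - f) \<ge> l * (1 + \<epsilon> / 2) - 1" by linarith
  have "- ln t \<le> - ln \<eta>" using t \<eta> by (simp add: ln_mono)
  also have "\<dots> = ln (1 / \<eta>)" using \<eta> by (simp add: ln_div)
  also have "\<dots> \<le> 1 / \<eta>" using \<eta> ln_le_minus_one[of "1 / \<eta>"] by simp
  also have "\<dots> = 2 * a / \<epsilon>" by (simp add: \<eta>_def)
  finally have "c * l * (- ln t) \<le> c * l * (2 * a / \<epsilon>)" using c l by (intro mult_left_mono) auto
  also have "\<dots> = \<epsilon> / 4 * l"
    using a \<epsilon> by (simp add: c_def degree_margin_def field_simps power2_eq_square)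
  finally have tilt: "- (c * l * ln t) \<le> \<epsilon> / 4 * l" by simp
  have "measure_pmf.prob (signed_graph n p \<delta>) {w. \<not> c * l \<le> vertex_weight n w v}
      \<le> exp (- (p * (real n - 1) * (1 - f)) - c * l * ln t)"
    unfolding f_def by (rule prob_small_signed_degree[OF p0 p(2) \<delta> v t0 t1])
  also have "\<dots> \<le> exp (1 - (1 + \<epsilon> / 4) * l)"
    using main tilt by (simp add: algebra_simps)
  finally show ?thesis by (simp add: c_def l_def)
qed

text \<open>
  The constants are chosen in terms of \<open>a\<close> and \<open>\<epsilon>\<close> alone; \<open>L\<close> is the size of \<open>ln n\<close> from which the error
  terms of lower order are absorbed. The four summands bound the failure of the maximal degree, of
  the signed degrees, of the light pairs, and of the sparsity of small vertex sets. For the last one, a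
  set of \<open>k\<close> vertices fails with probability at most \<open>n\<^sup>-\<^sup>2\<^sup>k\<close>, and summing over all nonempty sets gives
  \<open>(1 + n\<^sup>-\<^sup>2)\<^sup>n - 1\<close>.
\<close>
lemma prob_no_spectral_window:
  fixes a \<epsilon> :: real
  assumes a: "a > 1" and \<epsilon>: "\<epsilon> > 0"
  obtains L where "\<And>n \<delta>. n \<ge> 2 \<Longrightarrow> a * ln (real n) / n \<le> 1 \<Longrightarrow> L \<le> ln (real n) \<Longrightarrow> 0 \<le> \<delta> \<Longrightarrow> \<delta> \<le> 1 \<Longrightarrow>
      a * (1 - sqrt (1 - \<delta>\<^sup>2)) \<ge> 1 + \<epsilon> \<Longrightarrow>
      measure_pmf.prob (signed_graph n (a * ln (real n) / n) \<delta>)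
        {w. \<not> spectral_window n w (degree_margin a \<epsilon> / 2 * ln (real n)) (2 * (2 * a + 2) * ln (real n))}
      \<le> 1 / n + exp 1 * exp (- (\<epsilon> / 4) * ln (real n)) + exp (- real n) + (exp (1 / n) - 1)"
proof -
  define c where "c = degree_margin a \<epsilon>"
  define K where "K = 2 * a + 2"
  define \<gamma> where "\<gamma> = min 1 (c / (64 * K))"
  define \<theta> where "\<theta> = c * \<gamma> / 64"
  \<comment> \<open>This \<open>\<tau>\<close> makes the light-pair bound \<open>exp (- 7 n)\<close>, which beats the \<open>exp (6 n)\<close> integer vectors.\<close>
  define \<tau> where "\<tau> = c / 256"
  \<comment> \<open>With \<open>\<Lambda> \<theta> = 3\<close> a dense set of \<open>k\<close> vertices has probability \<open>exp (- 3 k ln n)\<close> up to lower order.\<close>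
  define \<Lambda> where "\<Lambda> = 3 / \<theta>"
  have c: "c > 0" using a \<epsilon> by (simp add: c_def degree_margin_def)
  have K: "K > 0" using a by (simp add: K_def)
  have \<gamma>: "0 < \<gamma>" "\<gamma> \<le> 1" using c K by (auto simp: \<gamma>_def)
  have \<gamma>K: "\<gamma> * K \<le> c / 64"
  proof -
    have "\<gamma> * K \<le> c / (64 * K) * K" using K by (intro mult_right_mono) (auto simp: \<gamma>_def)
    then show ?thesis using K by simp
  qed
  have \<theta>: "\<theta> > 0" "\<theta> / \<gamma> \<le> c / 64" using c \<gamma> by (auto simp: \<theta>_def)
  have \<tau>: "\<tau> > 0" using c by (simp add: \<tau>_def)
  have \<Lambda>: "\<Lambda> > 0" "\<Lambda> * \<theta> = 3" using \<theta> by (auto simp: \<Lambda>_def)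
  define L where "L = max (128 * a / (c * \<tau>)) (max (2 * a / \<tau>\<^sup>2) (4 * a * exp \<Lambda> / (\<gamma> * \<tau>)))"
  show ?thesis
  proof (rule that[of L])
    fix n :: nat and \<delta> :: real
    assume n: "n \<ge> 2" and p1: "a * ln (real n) / n \<le> 1" and Ll: "L \<le> ln (real n)"
      and \<delta>: "0 \<le> \<delta>" "\<delta> \<le> 1" and gap: "a * (1 - sqrt (1 - \<delta>\<^sup>2)) \<ge> 1 + \<epsilon>"
    define l where "l = ln (real n)"
    define p where "p = a * l / n"
    have n0: "real n > 0" using n by simp
    have l: "l > 0" using n by (simp add: l_def)
    have exp_l: "exp l = n" using n by (simp add: l_def)
    have p: "0 \<le> p" "p \<le> 1" using a l n p1 by (auto simp: p_def l_def)
    have pn: "p * n = a * l" using n by (simp add: p_def)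
    have "128 * a / (c * \<tau>) \<le> l" "2 * a / \<tau>\<^sup>2 \<le> l" "4 * a * exp \<Lambda> / (\<gamma> * \<tau>) \<le> l"
      using Ll by (auto simp: L_def l_def)
    then have L1: "8 * a \<le> c / 16 * \<tau> * l" and L2: "2 * a \<le> \<tau>\<^sup>2 * l" and L3: "4 * a * exp \<Lambda> / (\<gamma> * \<tau>) \<le> l"
      using c \<tau> by (auto simp: field_simps)
    let ?M = "signed_graph n p \<delta>"
    let ?A = "{w. \<exists>v\<in>{..<n}. \<not> vertex_weight n (\<lambda>e. \<bar>w e\<bar>) v \<le> K * l}"
    let ?B = "{w. \<exists>v\<in>{..<n}. \<not> c * l \<le> vertex_weight n w v}"
    let ?C = "{w. \<exists>m\<in>int_vectors n.
      \<not> (\<Sum>e\<in>light_pairs n (\<tau> * l) m. (w e - p * \<delta>) * (\<Prod>k\<in>e. real_of_int (m k))) \<le> c / 16 * l * n}"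
    let ?\<T> = "{T \<in> Pow {..<n} - {{}}. real (card T) \<le> 4 * real n / (\<gamma> * (\<tau> * l))}"
    let ?D = "{w. \<exists>T\<in>?\<T>. \<not> (\<Sum>e\<in>{e \<in> pairs n. e \<subseteq> T}. \<bar>w e\<bar>) \<le> \<theta> * l * card T}"
    have cover: "{w. \<not> spectral_window n w (c / 2 * l) (2 * K * l)} \<subseteq> ?A \<union> (?B \<union> (?C \<union> ?D))"
    proof (rule subsetI, rule ccontr)
      fix w assume w: "w \<in> {w. \<not> spectral_window n w (c / 2 * l) (2 * K * l)}" "w \<notin> ?A \<union> (?B \<union> (?C \<union> ?D))"
      have "p * \<delta> * n \<le> a * l"
        using pn mult_right_mono[OF mult_left_le[OF \<delta>(2) p(1)], of n] by simp
      then have "spectral_window n w (c / 2 * l) (2 * K * l)"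
      proof (intro spectral_window_of_regular[where \<mu> = "p * \<delta>" and a = a and \<tau> = \<tau> and \<gamma> = \<gamma> and \<theta> = \<theta>])
        fix T assume T: "T \<subseteq> {..<n}" "real (card T) \<le> 4 * real n / (\<gamma> * (\<tau> * l))"
        show "(\<Sum>e\<in>{e \<in> pairs n. e \<subseteq> T}. \<bar>w e\<bar>) \<le> \<theta> * l * card T"
        proof (cases "T = {}")
          case True
          then have "{e \<in> pairs n. e \<subseteq> T} = {}" by (auto simp: nsets_def)
          then show ?thesis using True by (simp only: sum.empty) simp
        qed (use w T in auto)
      qed (use w n l p \<delta> K \<gamma> \<theta> \<tau> \<gamma>K L1 in auto)
      with w show False by simp
    qed
    have A: "measure_pmf.prob ?M ?A \<le> 1 / n"
    proof -
      have "measure_pmf.prob ?M ?A \<le> (\<Sum>v<n. exp (2 * p * n - K * l))"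
        by (intro prob_union_bound prob_large_degree p \<delta>) auto
      also have "2 * p * n - K * l = - l - l" using pn by (simp add: K_def algebra_simps)
      also have "exp (- l - l) = inverse (real n) / n" by (simp only: exp_diff exp_minus exp_l)
      also have "(\<Sum>v<n. inverse (real n) / n) = 1 / n" using n by (simp add: field_simps)
      finally show ?thesis .
    qed
    have B: "measure_pmf.prob ?M ?B \<le> exp 1 * exp (- (\<epsilon> / 4) * l)"
    proof -
      have "measure_pmf.prob ?M ?B \<le> (\<Sum>v<n. exp (1 - (1 + \<epsilon> / 4) * l))"
      proof (rule prob_union_bound)
        fix v assume "v \<in> {..<n}"
        then show "measure_pmf.prob ?M {w. \<not> c * l \<le> vertex_weight n w v} \<le> exp (1 - (1 + \<epsilon> / 4) * l)"
          unfolding c_def l_def using p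
          by (intro prob_signed_degree_below_margin[OF a \<epsilon> \<delta> gap]) (auto simp: p_def l_def n)
      qed simp
      also have "\<dots> = exp l * exp (1 - (1 + \<epsilon> / 4) * l)" by (simp add: exp_l)
      also have "\<dots> = exp 1 * exp (- (\<epsilon> / 4) * l)"
        by (simp add: algebra_simps flip: exp_add)
      finally show ?thesis .
    qed
    have C: "measure_pmf.prob ?M ?C \<le> exp (- real n)"
    proof -
      have h: "\<tau> * l > 0" using \<tau> l by simp
      have "measure_pmf.prob ?M ?C \<le>
          (\<Sum>m\<in>int_vectors n. exp (2 * p * (real n)\<^sup>2 / (\<tau> * l)\<^sup>2 - (c / 16 * l * n) / (2 * (\<tau> * l))))"
        by (intro prob_union_bound prob_large_light_sum p \<delta> h finite_int_vectors)
      also have "\<dots> \<le> (\<Sum>m\<in>int_vectors n. exp (- 7 * real n))"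
      proof -
        have "(c / 16 * l * n) / (2 * (\<tau> * l)) = 8 * n"
          using c l by (simp add: \<tau>_def field_simps)
        moreover have "2 * p * (real n)\<^sup>2 / (\<tau> * l)\<^sup>2 = 2 * a * n / (\<tau>\<^sup>2 * l)"
          using l n by (simp add: p_def power2_eq_square field_simps)
        moreover have "2 * a * n / (\<tau>\<^sup>2 * l) \<le> n"
          using mult_right_mono[OF L2, of n] \<tau> l by (simp add: divide_le_eq mult.commute mult.left_commute)
        ultimately show ?thesis by (intro sum_mono) simp
      qed
      also have "\<dots> = card (int_vectors n) * exp (- 7 * real n)" by simp
      also have "\<dots> \<le> exp (6 * real n) * exp (- 7 * real n)"
        by (intro mult_right_mono card_int_vectors_le) auto
      also have "\<dots> = exp (- real n)" by (simp flip: exp_add)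
      finally show ?thesis .
    qed
    have D: "measure_pmf.prob ?M ?D \<le> exp (1 / n) - 1"
    proof -
      define q where "q = exp (- 2 * l)"
      have q: "q = 1 / (real n)\<^sup>2"
        using exp_add[of "- l" "- l"] by (simp add: q_def exp_minus exp_l power2_eq_square field_simps)
      have "measure_pmf.prob ?M ?D \<le> (\<Sum>T\<in>?\<T>. q ^ card T)"
      proof (rule prob_union_bound)
        fix T assume T: "T \<in> ?\<T>"
        define s where "s = real (card T)"
        have "measure_pmf.prob ?M {w. \<not> (\<Sum>e\<in>{e \<in> pairs n. e \<subseteq> T}. \<bar>w e\<bar>) \<le> \<theta> * l * card T}
          \<le> exp (p * exp \<Lambda> * s\<^sup>2 - \<Lambda> * (\<theta> * l * s))"
          unfolding s_def by (rule prob_dense_subset) (use T p \<delta> \<Lambda> in auto)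
        also have "p * exp \<Lambda> * s\<^sup>2 \<le> s * l"
        proof -
          have "p * exp \<Lambda> * s\<^sup>2 = s * (p * exp \<Lambda> * s)" by (simp add: power2_eq_square)
          also have "\<dots> \<le> s * (p * exp \<Lambda> * (4 * real n / (\<gamma> * (\<tau> * l))))"
            using T p by (intro mult_left_mono) (auto simp: s_def)
          also have "p * exp \<Lambda> * (4 * real n / (\<gamma> * (\<tau> * l))) = 4 * a * exp \<Lambda> / (\<gamma> * \<tau>)"
            using l n by (simp add: p_def field_simps)
          also have "s * \<dots> \<le> s * l" using L3 by (intro mult_left_mono) (auto simp: s_def)
          finally show ?thesis .
        qed
        also have "s * l - \<Lambda> * (\<theta> * l * s) = card T * (- 2 * l)"
        proof -
          have "\<Lambda> * (\<theta> * l * s) = (\<Lambda> * \<theta>) * (l * s)" by (simp only: mult.assoc)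
          also have "\<dots> = 3 * (l * s)" by (simp only: \<Lambda>)
          finally show ?thesis by (simp add: s_def algebra_simps)
        qed
        also have "exp (card T * (- 2 * l)) = q ^ card T" unfolding q_def by (rule exp_of_nat_mult)
        finally show "measure_pmf.prob ?M {w. \<not> (\<Sum>e\<in>{e \<in> pairs n. e \<subseteq> T}. \<bar>w e\<bar>) \<le> \<theta> * l * card T} \<le> q ^ card T"
          by simp
      qed auto
      also have "\<dots> \<le> (\<Sum>T\<in>Pow {..<n} - {{}}. q ^ card T)"
        by (intro sum_mono2) (auto simp: q_def)
      also have "\<dots> = (1 + q) ^ n - 1" by (rule sum_powers_nonempty_subsets)
      also have "(1 + q) ^ n \<le> (exp q) ^ n" by (intro power_mono) (auto simp: q_def add_nonneg_nonneg)
      also have "(exp q) ^ n = exp (1 / n)" using n by (simp add: q power2_eq_square flip: exp_of_nat_mult)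
      finally show ?thesis by simp
    qed
    have un: "measure_pmf.prob ?M (X \<union> Z) \<le> measure_pmf.prob ?M X + measure_pmf.prob ?M Z" for X Z
      by (rule measure_Un_le) auto
    have "measure_pmf.prob ?M {w. \<not> spectral_window n w (c / 2 * l) (2 * K * l)}
        \<le> measure_pmf.prob ?M (?A \<union> (?B \<union> (?C \<union> ?D)))"
      by (rule measure_pmf.finite_measure_mono[OF cover]) simp
    also have "\<dots> \<le> 1 / n + exp 1 * exp (- (\<epsilon> / 4) * l) + exp (- real n) + (exp (1 / n) - 1)"
      using un[of ?A "?B \<union> (?C \<union> ?D)"] un[of ?B "?C \<union> ?D"] un[of ?C ?D] A B C D by linarith
    finally show "measure_pmf.prob (signed_graph n (a * ln (real n) / n) \<delta>)
        {w. \<not> spectral_window n w (degree_margin a \<epsilon> / 2 * ln (real n)) (2 * (2 * a + 2) * ln (real n))}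
      \<le> 1 / n + exp 1 * exp (- (\<epsilon> / 4) * ln (real n)) + exp (- real n) + (exp (1 / n) - 1)"
      by (simp add: c_def l_def K_def p_def)
  qed
qed

lemma cost_matrix_gauged:
  assumes z: "z \<in> sign_vecs n" and E: "E \<subseteq> pairs n"
  shows "cost_matrix n E R = mat n n (\<lambda>(i, j). z $ i * z $ j * gauged_weights z E R {i, j})"
proof (rule eq_matI)
  fix i j assume "i < dim_row (mat n n (\<lambda>(i, j). z $ i * z $ j * gauged_weights z E R {i, j}))"
    "j < dim_col (mat n n (\<lambda>(i, j). z $ i * z $ j * gauged_weights z E R {i, j}))"
  then have ij: "i < n" "j < n" by auto
  have "z $ i * z $ j * gauged_weights z E R {i, j} = R {i, j}" if e: "{i, j} \<in> E"
  proof -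
    have ne: "i \<noteq> j" using subsetD[OF E e] by (auto simp: nsets_def)
    have "z $ i * z $ j * gauged_weights z E R {i, j} = (\<Prod>k\<in>{i, j}. z $ k) * (\<Prod>k\<in>{i, j}. z $ k) * R {i, j}"
      using ne e by (simp add: gauged_weights_def)
    also have "\<dots> = R {i, j}" by (simp only: prod_sign_vec_sq[OF z subsetD[OF E e]] mult_1)
    finally show ?thesis .
  qed
  then show "cost_matrix n E R $$ (i, j) = mat n n (\<lambda>(i, j). z $ i * z $ j * gauged_weights z E R {i, j}) $$ (i, j)"
    using ij by (auto simp: cost_matrix_def gauged_weights_def)
qed (auto simp: cost_matrix_def)

lemma set_pmf_synchronization_model:
  "(E, R) \<in> set_pmf (synchronization_model n p z \<delta>) \<Longrightarrow> E \<subseteq> pairs n"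
  by (auto simp: synchronization_model_def erdos_renyi_def)

theorem corollary2:
  fixes a \<epsilon> :: real
  assumes "a > 1" and "\<epsilon> > 0"
  shows "\<exists>r\<^sub>0 :: nat. \<forall>(\<delta> :: real) (z :: nat \<Rightarrow> real vec).
    \<delta> \<in> {0..1} \<longrightarrow> (\<forall>n. z n \<in> sign_vecs n) \<longrightarrow> a * (1 - sqrt (1 - \<delta>\<^sup>2)) \<ge> 1 + \<epsilon> \<longrightarrow>
    (\<lambda>n. measure_pmf.prob (synchronization_model n (a * ln (real n) / real n) (z n) \<delta>)
       {(E, R). \<forall>r\<ge>r\<^sub>0. \<forall>Y.
          second_order_critical n r (\<lambda>X. frob_inner (cost_matrix n E R) (X * X\<^sup>T)) Y \<longrightarrow>
          (\<exists>u \<in> carrier_vec r. u \<bullet> u = 1 \<and> Y = outer_prod (z n) u)})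
    \<longlonglongrightarrow> 1"
proof -
  define c where "c = degree_margin a \<epsilon>"
  define K where "K = 2 * a + 2"
  have c: "c > 0" using assms by (simp add: c_def degree_margin_def)
  have K: "K > 0" using assms by (simp add: K_def)
  \<comment> \<open>The window is \<open>[c / 2 * ln n, 2 * K * ln n]\<close>, so \<open>(r - 1) c > 8 K\<close> is what alignment requires.\<close>
  define r0 where "r0 = nat \<lceil>8 * K / c\<rceil> + 2"
  obtain L where L: "\<And>n \<delta>. n \<ge> 2 \<Longrightarrow> a * ln (real n) / n \<le> 1 \<Longrightarrow> L \<le> ln (real n) \<Longrightarrow> 0 \<le> \<delta> \<Longrightarrow> \<delta> \<le> 1 \<Longrightarrow>
      a * (1 - sqrt (1 - \<delta>\<^sup>2)) \<ge> 1 + \<epsilon> \<Longrightarrow>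
      measure_pmf.prob (signed_graph n (a * ln (real n) / n) \<delta>)
        {w. \<not> spectral_window n w (c / 2 * ln (real n)) (2 * K * ln (real n))}
      \<le> 1 / n + exp 1 * exp (- (\<epsilon> / 4) * ln (real n)) + exp (- real n) + (exp (1 / n) - 1)"
    unfolding c_def K_def using prob_no_spectral_window[OF assms] by blast
  define err where "err n = 1 / real n + exp 1 * exp (- (\<epsilon> / 4) * ln (real n)) + exp (- real n) + (exp (1 / real n) - 1)" for n :: nat
  have "(\<lambda>n::nat. exp (- (\<epsilon> / 4) * ln (real n))) \<longlonglongrightarrow> 0" using assms by real_asymp
  moreover have "(\<lambda>n::nat. 1 / real n + exp (- real n) + (exp (1 / real n) - 1)) \<longlonglongrightarrow> 0" by real_asymp
  ultimately have "(\<lambda>n::nat. 1 - (exp 1 * exp (- (\<epsilon> / 4) * ln (real n))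
      + (1 / real n + exp (- real n) + (exp (1 / real n) - 1)))) \<longlonglongrightarrow> 1 - (exp 1 * 0 + 0)"
    by (intro tendsto_intros)
  then have err: "(\<lambda>n. 1 - err n) \<longlonglongrightarrow> 1" by (simp add: err_def algebra_simps)
  have ev: "\<forall>\<^sub>F n in sequentially. n \<ge> 2 \<and> a * ln (real n) / n \<le> 1 \<and> L \<le> ln (real n)"
    by (intro eventually_conj) real_asymp+
  show ?thesis
  proof (intro exI[of _ r0] allI impI)
    fix \<delta> :: real and z :: "nat \<Rightarrow> real vec"
    assume \<delta>: "\<delta> \<in> {0..1}" and z: "\<forall>n. z n \<in> sign_vecs n" and gap: "a * (1 - sqrt (1 - \<delta>\<^sup>2)) \<ge> 1 + \<epsilon>"
    define model where "model n = synchronization_model n (a * ln (real n) / real n) (z n) \<delta>" for n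
    define aligned where "aligned n = {(E, R). \<forall>r\<ge>r0. \<forall>Y.
          second_order_critical n r (\<lambda>X. frob_inner (cost_matrix n E R) (X * X\<^sup>T)) Y \<longrightarrow>
          (\<exists>u \<in> carrier_vec r. u \<bullet> u = 1 \<and> Y = outer_prod (z n) u)}" for n
    have "\<forall>\<^sub>F n in sequentially. 1 - err n \<le> measure_pmf.prob (model n) (aligned n)"
      using ev
    proof (rule eventually_mono)
      fix n assume n: "n \<ge> 2 \<and> a * ln (real n) / n \<le> 1 \<and> L \<le> ln (real n)"
      define l where "l = ln (real n)"
      have l: "l > 0" using n by (simp add: l_def)
      define W where "W = {w. spectral_window n w (c / 2 * l) (2 * K * l)}"
      let ?g = "\<lambda>(E, R). gauged_weights (z n) E R"
      have zn: "z n \<in> sign_vecs n" using z by blast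
      have incl: "(E, R) \<in> aligned n" if m: "(E, R) \<in> set_pmf (model n)" and w: "?g (E, R) \<in> W" for E R
        unfolding aligned_def
      proof (clarify)
        fix r Y assume r: "r0 \<le> r"
          and crit: "second_order_critical n r (\<lambda>X. frob_inner (cost_matrix n E R) (X * X\<^sup>T)) Y"
        have E: "E \<subseteq> pairs n" using m unfolding model_def by (rule set_pmf_synchronization_model)
        have "8 * K / c < real r - 1" using r unfolding r0_def by linarith
        then have "8 * K < (real r - 1) * c" using c by (simp add: field_simps)
        then have "8 * K * (l / 2) < (real r - 1) * c * (l / 2)" using l by (intro mult_strict_right_mono) auto
        then have rk: "2 * (2 * K * l) < (real r - 1) * (c / 2 * l)" by (simp add: algebra_simps)
        show "\<exists>u\<in>carrier_vec r. u \<bullet> u = 1 \<and> Y = outer_prod (z n) u"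
          by (rule second_order_critical_aligned[OF _ zn cost_matrix_gauged[OF zn E] _ _ rk _ crit])
            (use n w l K r in \<open>auto simp: W_def r0_def\<close>)
      qed
      have "1 - measure_pmf.prob (signed_graph n (a * ln (real n) / n) \<delta>) (- W) =
          measure_pmf.prob (signed_graph n (a * ln (real n) / n) \<delta>) W"
        using measure_pmf.prob_compl[of W] by (simp add: Compl_eq_Diff_UNIV)
      also have "\<dots> = measure_pmf.prob (model n) (?g -` W)"
        by (simp add: model_def flip: map_gauged_synchronization_model[OF zn])
      also have "\<dots> \<le> measure_pmf.prob (model n) (aligned n)"
        by (intro measure_pmf.finite_measure_mono_AE AE_pmfI) (use incl in auto)
      finally show "1 - err n \<le> measure_pmf.prob (model n) (aligned n)"
        using L[of n \<delta>] n \<delta> gap by (simp add: err_def W_def l_def Compl_eq)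
    qed
    then have "(\<lambda>n. measure_pmf.prob (model n) (aligned n)) \<longlonglongrightarrow> 1"
      by (intro tendsto_sandwich[OF _ _ err tendsto_const]) auto
    then show "(\<lambda>n. measure_pmf.prob (synchronization_model n (a * ln (real n) / real n) (z n) \<delta>)
       {(E, R). \<forall>r\<ge>r0. \<forall>Y.
          second_order_critical n r (\<lambda>X. frob_inner (cost_matrix n E R) (X * X\<^sup>T)) Y \<longrightarrow>
          (\<exists>u \<in> carrier_vec r. u \<bullet> u = 1 \<and> Y = outer_prod (z n) u)}) \<longlonglongrightarrow> 1"
      by (simp add: model_def aligned_def)
  qed
qed

end
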